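(* Let $G=(V,E)$ be a finite, connected graph with $V=\{1,\ldots,m\}$ and $|E|=N\ge 1$, and let $\alpha>0$. Let $x(n)=(x_1(n),\ldots,x_m(n))$, $n\ge 0$, be the proportions of balls in the generalized Pólya urn process on $G$ with parameter $\alpha$ (defined in the context), for arbitrary initial numbers of balls $B_i(0)\ge 1$. Then almost surely the limit set of $(x(n))_{n\ge 0}$ (its set of accumulation points) is contained in the equilibria set $\Lambda$ of the vector field $F$ (defined in the context).
   Context: Graphs are simple and undirected; $i\sim j$ means $\{i,j\}\in E$. Generalized Pólya urn process on $G$ with parameter $\alpha>0$: each vertex $i$ carries a bin, initially with an integer number $B_i(0)\ge 1$ of balls. Let $\mathcal F_n$ be the sigma-algebra generated by the process up to step $n$. At step $n+1$, for each edge $\{i,j\}\in E$ exactly one ball is added, either to $i$ or to $j$; conditionally on $\mathcal F_n$, the ball is added to $i$ with probability $\frac{B_i(n)^\alpha}{B_i(n)^\alpha+B_j(n)^\alpha}$ (and to $j$ otherwise), and the choices for distinct edges are independent. $B_i(n)$ is the number of balls at $i$ after step $n$. With $N_0=\sum_{i=1}^m B_i(0)$, set $x_i(n)=\frac{B_i(n)}{N_0+nN}$. Vector field and equilibria set: fix a constant $0<c<1/N$ and let $\Delta$ be the set of $(x_1,\ldots,x_m)\in\mathbb{R}^m$ with $x_i\ge 0$ for all $i$, $\sum_{i=1}^m x_i=1$, and $x_i+x_j\ge c$ for all $\{i,j\}\in E$. Define $F=(F_1,\ldots,F_m)$ on $\Delta$ by $$F_i(x_1,\ldots,x_m)=-x_i+\frac1N\sum_{j\sim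 i}\frac{x_i^\alpha}{x_i^\alpha+x_j^\alpha}.$$ The equilibria set is $\Lambda=\{x\in\Delta: F(x)=0\}$. *)

theory Defs
  imports "HOL-Probability.Probability"
begin

(* Undirected graphs have all elements of the finite type 'v as vertices and are given by their
   set E of edges {i, j}. *)

definition simple_graph :: "'v set set \<Rightarrow> bool" where
  "simple_graph E \<longleftrightarrow> (\<forall>e\<in>E. card e = 2)"

definition connected_graph :: "'v set set \<Rightarrow> bool" where
  "connected_graph E \<longleftrightarrow> (\<forall>u v. (u, v) \<in> {(i, j). {i, j} \<in> E}\<^sup>*)"

definition cprob :: "'w measure \<Rightarrow> 'w measure \<Rightarrow> 'w set \<Rightarrow> 'w \<Rightarrow> real" where
  "cprob M F A = real_cond_exp M F (indicator A)"

(* The definition of indep_vars, with probabilities replaced by conditional probabilities. *)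
definition cond_indep_vars ::
  "'w measure \<Rightarrow> 'w measure \<Rightarrow> ('i \<Rightarrow> 'b measure) \<Rightarrow> ('i \<Rightarrow> 'w \<Rightarrow> 'b) \<Rightarrow> 'i set \<Rightarrow> bool" where
  "cond_indep_vars M F M' X I \<longleftrightarrow>
     (\<forall>i\<in>I. X i \<in> measurable M (M' i)) \<and>
     (\<forall>J A. J \<subseteq> I \<longrightarrow> J \<noteq> {} \<longrightarrow> finite J \<longrightarrow> (\<forall>j\<in>J. A j \<in> sets (M' j)) \<longrightarrow>
        (AE \<omega> in M. cprob M F (\<Inter>j\<in>J. X j -` A j \<inter> space M) \<omega>
                    = (\<Prod>j\<in>J. cprob M F (X j -` A j \<inter> space M) \<omega>)))"

(* The sigma-algebra generated by B 0, ..., B n. *)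
definition history :: "'w measure \<Rightarrow> (nat \<Rightarrow> 'v \<Rightarrow> 'w \<Rightarrow> nat) \<Rightarrow> nat \<Rightarrow> 'w measure" where
  "history M B n = sigma (space M) {B k i -` A \<inter> space M | k i A. k \<le> n}"

(* B n i is the number of balls at i after step n, and C n e is the endpoint of the edge e that
   receives the ball of e at step n + 1. *)
locale polya_urn = prob_space M
  for M :: "'w measure"
    and E :: "'v::finite set set"
    and \<alpha> :: real
    and B0 :: "'v \<Rightarrow> nat"
    and B :: "nat \<Rightarrow> 'v \<Rightarrow> 'w \<Rightarrow> nat"
    and C :: "nat \<Rightarrow> 'v set \<Rightarrow> 'w \<Rightarrow> 'v" +
  assumes initial_pos: "B0 i \<ge> 1"
    and initial: "\<omega> \<in> space M \<Longrightarrow> B 0 i \<omega> = B0 i"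
    and step: "\<omega> \<in> space M \<Longrightarrow> B (Suc n) i \<omega> = B n i \<omega> + card {e \<in> E. C n e \<omega> = i}"
    and choice_measurable: "e \<in> E \<Longrightarrow> C n e \<in> measurable M (count_space UNIV)"
    and choice_endpoint: "e \<in> E \<Longrightarrow> \<omega> \<in> space M \<Longrightarrow> C n e \<omega> \<in> e"
    and choice_prob: "{i, j} \<in> E \<Longrightarrow>
      AE \<omega> in M. cprob M (history M B n) {\<omega> \<in> space M. C n {i, j} \<omega> = i} \<omega>
        = real (B n i \<omega>) powr \<alpha> / (real (B n i \<omega>) powr \<alpha> + real (B n j \<omega>) powr \<alpha>)"
    and choice_indep: "cond_indep_vars M (history M B n) (\<lambda>_. count_space UNIV) (C n) E"

definition proportions ::
  "'v::finite set set \<Rightarrow> ('v \<Rightarrow> nat) \<Rightarrow> (nat \<Rightarrow> 'v \<Rightarrow> 'w \<Rightarrow> nat) \<Rightarrow> 'w \<Rightarrow> nat \<Rightarrow> real ^ 'v" where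
  "proportions E B0 B \<omega> n =
     (\<chi> i. real (B n i \<omega>) / (real (\<Sum>j\<in>UNIV. B0 j) + real n * real (card E)))"

definition domain_\<Delta> :: "'v::finite set set \<Rightarrow> real \<Rightarrow> (real ^ 'v) set" where
  "domain_\<Delta> E c = {x. (\<forall>i. x $ i \<ge> 0) \<and> (\<Sum>i\<in>UNIV. x $ i) = 1 \<and>
                       (\<forall>i j. {i, j} \<in> E \<longrightarrow> x $ i + x $ j \<ge> c)}"

definition field_F :: "'v::finite set set \<Rightarrow> real \<Rightarrow> real ^ 'v \<Rightarrow> real ^ 'v" where
  "field_F E \<alpha> x = (\<chi> i. - x $ i + 1 / real (card E) *
     (\<Sum>j | {i, j} \<in> E. (x $ i) powr \<alpha> / ((x $ i) powr \<alpha> + (x $ j) powr \<alpha>)))"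

definition equilibria :: "'v::finite set set \<Rightarrow> real \<Rightarrow> real \<Rightarrow> (real ^ 'v) set" where
  "equilibria E \<alpha> c = {x \<in> domain_\<Delta> E c. field_F E \<alpha> x = 0}"

(* Accumulation points of a sequence, i.e. the limits of its convergent subsequences
   (not the limit points of its range). *)
definition limit_set :: "(nat \<Rightarrow> 'a::topological_space) \<Rightarrow> 'a set" where
  "limit_set X = {y. \<exists>r. strict_mono r \<and> (X \<circ> r) \<longlonglongrightarrow> y}"

end

theory Submission
  imports Defs
begin

text \<open>The function L x = - sum_i x_i + 1 / (\<alpha> N) * sum_edges ln (x_i^\<alpha> + x_j^\<alpha>) has partial
  derivatives F_i / x_i, so along the urn process its conditional mean increment is about
  1 / (n + 1) * sum_i F_i^2 / x_i. L is bounded above, so taking expectations and telescoping gives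
  E (sum_n F_i(x(n))^2 / (n + 1)) < \<infinity>, provided the second order errors are summable or absorbed by
  the drift. Hence almost surely sum_n F_i(x(n))^2 / (n + 1) < \<infinity>; as x(n) moves by O(1 / n) and F
  is continuous, F vanishes at every accumulation point. Neither convergence of L(x(n)) nor any
  information on the critical values of L is needed.

  For \<alpha> < 2, L is not twice differentiable at the boundary. The errors are therefore
  estimated in terms of the ball numbers B_i: with r_i = sum_{j ~ i} B_i^(\<alpha>-1) / (B_i^\<alpha> + B_j^\<alpha>)
  and T = sum_i B_i the drift is sum_i B_i (r_i - N / T)^2, the error is O(sum_i B_i r_i^3), and r_i
  tends to 0 uniformly.\<close>

section \<open>Inequalities for powers and logarithms\<close>

lemma deriv_shifted_powr:
  fixes b \<alpha> c u :: real
  assumes "b + u > 0"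
  shows "((\<lambda>u. (b + u) powr \<alpha> - c * (b + u) powr (\<alpha> - 1) - u * (\<alpha> * b powr (\<alpha> - 1)))
    has_real_derivative
      (\<alpha> * (b + u) powr (\<alpha> - 1) - c * ((\<alpha> - 1) * (b + u) powr (\<alpha> - 2)) - \<alpha> * b powr (\<alpha> - 1))) (at u)"
  using assms by (auto intro!: derivative_eq_intros simp: algebra_simps)

text \<open>With \<open>t = b + u\<close>, the left side is
  \<open>(t / b) powr (1 - \<alpha>)\<close> times \<open>t powr (\<alpha> - 1)\<close>. Young's
  inequality with second factor 1 (that is, Bernoulli's) linearises the concave power of
  \<open>t / b\<close>; as b \<ge> 1 and u \<le> d, the factor \<open>t * (u / b)\<close> stays
  below \<open>d * (1 + d)\<close>.\<close>

lemma powr_minus_one_decrease: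
  fixes b u \<alpha> :: real
  assumes "0 < \<alpha>" "\<alpha> < 1" "1 \<le> b" "0 \<le> u" "u \<le> d"
  shows "b powr (\<alpha> - 1) \<le> (b + u) powr (\<alpha> - 1) + (1 - \<alpha>) * (d * (1 + d)) * (b + u) powr (\<alpha> - 2)"
proof -
  define t where "t = b + u"
  have t: "t > 0" "t \<ge> b" using assms by (auto simp: t_def)
  have "(t / b) powr (1 - \<alpha>) * 1 powr \<alpha> \<le> (1 - \<alpha>) * (t / b) + \<alpha> * 1"
    using assms t by (intro Youngs_inequality_0) auto
  then have *: "(t / b) powr (1 - \<alpha>) \<le> 1 + (1 - \<alpha>) * (u / b)"
    using assms by (simp add: t_def field_simps)
  have "t * (u / b) = u * (1 + u / b)"
    using assms by (simp add: t_def field_simps)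
  also have "\<dots> \<le> d * (1 + d)"
  proof (intro mult_mono add_mono)
    have "u / b \<le> u / 1" using assms by (intro divide_left_mono) auto
    then show "u / b \<le> d" using assms by simp
  qed (use assms in auto)
  finally have **: "t * (u / b) \<le> d * (1 + d)" .
  have "b powr (\<alpha> - 1) = (t / b) powr (1 - \<alpha>) * t powr (\<alpha> - 1)"
    using assms t by (simp add: powr_divide powr_diff field_simps)
  also have "\<dots> \<le> (1 + (1 - \<alpha>) * (u / b)) * t powr (\<alpha> - 1)"
    using * by (intro mult_right_mono) auto
  also have "\<dots> = t powr (\<alpha> - 1) + (1 - \<alpha>) * (t * (u / b)) * t powr (\<alpha> - 2)"
  proof -
    have "t powr (\<alpha> - 1) = t * t powr (\<alpha> - 2)"
      using t powr_mult_base[of t "\<alpha> - 2"] by simp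
    then show ?thesis by (simp only:) (simp add: algebra_simps)
  qed
  also have "\<dots> \<le> t powr (\<alpha> - 1) + (1 - \<alpha>) * (d * (1 + d)) * t powr (\<alpha> - 2)"
    using assms ** by (intro add_left_mono mult_right_mono mult_left_mono) auto
  finally show ?thesis by (simp add: t_def)
qed

text \<open>For \<alpha> < 1 one takes b powr \<alpha> minus a multiple of b powr (\<alpha> - 1). Without this correction
  the concavity of b powr \<alpha> costs a term of order b powr (\<alpha> - 2) at each step, which the drift
  absorbs only at vertices with many balls.\<close>
lemma superlinear_increment_powr:
  fixes \<alpha> :: real and d :: nat
  assumes \<alpha>: "\<alpha> > 0"
  obtains H :: "nat \<Rightarrow> real" and c :: real where
    "\<And>b k. b \<ge> 1 \<Longrightarrow> k \<le> d \<Longrightarrow> H b + \<alpha> * (real k * real b powr (\<alpha> - 1)) \<le> H (b + k)"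
    "\<And>b. b \<ge> 1 \<Longrightarrow> real b powr \<alpha> - c \<le> H b"
    "\<And>b. H b \<le> real b powr \<alpha>"
proof -
  \<comment> \<open>This makes \<open>c * (1 - \<alpha>)\<close> equal to \<alpha> times the
    constant of \<open>powr_minus_one_decrease\<close>, so the derivative below is nonnegative. For
    \<alpha> \<ge> 1 the function \<open>powr (\<alpha> - 1)\<close> is itself
    nondecreasing.\<close>
  define c where "c = (if \<alpha> < 1 then \<alpha> * (real d * (1 + real d)) else 0)"
  define H where "H = (\<lambda>b::nat. real b powr \<alpha> - c * real b powr (\<alpha> - 1))"
  have c0: "c \<ge> 0" using \<alpha> by (simp add: c_def)
  have 1: "H b + \<alpha> * (real k * real b powr (\<alpha> - 1)) \<le> H (b + k)" if b: "b \<ge> 1" and k: "k \<le> d" for b k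
  proof -
    \<comment> \<open>With the linear lower bound moved into \<open>?f\<close>, the claim becomes
      \<open>?f 0 \<le> ?f (real k)\<close>, a matter of monotonicity.\<close>
    let ?f = "\<lambda>u. (real b + u) powr \<alpha> - c * (real b + u) powr (\<alpha> - 1) - u * (\<alpha> * real b powr (\<alpha> - 1))"
    have "?f 0 \<le> ?f (real k)"
    proof (rule DERIV_nonneg_imp_nondecreasing[where f = ?f])
      fix u :: real assume u: "0 \<le> u" "u \<le> real k"
      let ?D = "\<alpha> * (real b + u) powr (\<alpha> - 1) - c * ((\<alpha> - 1) * (real b + u) powr (\<alpha> - 2)) - \<alpha> * real b powr (\<alpha> - 1)"
      have "?D \<ge> 0"
      proof (cases "\<alpha> < 1")
        case True
        have "\<alpha> * real b powr (\<alpha> - 1) \<le> \<alpha> * ((real b + u) powr (\<alpha> - 1)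
            + (1 - \<alpha>) * (real d * (1 + real d)) * (real b + u) powr (\<alpha> - 2))"
          using True \<alpha> b k u by (intro mult_left_mono powr_minus_one_decrease) auto
        then show ?thesis using True by (simp add: c_def algebra_simps)
      next
        case False
        then show ?thesis using \<alpha> u by (auto simp: c_def intro!: powr_mono2)
      qed
      then show "\<exists>y. (?f has_real_derivative y) (at u) \<and> y \<ge> 0"
        using deriv_shifted_powr[of "real b" u \<alpha> c] b u by (intro exI[of _ ?D]) auto
    qed simp
    then show ?thesis by (simp add: H_def algebra_simps)
  qed
  have 2: "real b powr \<alpha> - c \<le> H b" if "b \<ge> 1" for b
  proof (cases "\<alpha> < 1")
    case True
    then have "real b powr (\<alpha> - 1) \<le> 1" using that
      using powr_mono[of "\<alpha> - 1" 0 "real b"] by auto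
    then show ?thesis using c0 by (simp add: H_def mult_left_le)
  qed (simp add: H_def c_def)
  have 3: "H b \<le> real b powr \<alpha>" for b using c0 by (simp add: H_def)
  show thesis using that[of H c] 1 2 3 by blast
qed

text \<open>For z > 1 the left side is negative. Covering all z \<ge> 0 means that
  \<open>potential_step\<close> has no smallness of the increments to check.\<close>

lemma ln_one_plus_ge:
  fixes z :: real
  assumes "z \<ge> 0"
  shows "z - z\<^sup>2 \<le> ln (1 + z)"
  using ln_one_plus_pos_lower_bound[of z] assms
proof (cases "z \<le> 1")
  case False
  then have "z * 1 \<le> z * z" by (intro mult_left_mono) auto
  then have "z - z\<^sup>2 \<le> 0" by (simp add: power2_eq_square)
  also have "0 \<le> ln (1 + z)" using assms by simp
  finally show ?thesis .
qed auto

section \<open>Accumulation points of slowly moving sequences\<close>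

text \<open>The window from m to (1 + \<eta>) m carries harmonic mass of order \<eta>, while the
  sequence moves by at most L \<eta> along it; so f cannot be bounded away from 0 at an accumulation
  point.\<close>
lemma slow_sequence_limit_set:
  fixes x :: "nat \<Rightarrow> 'a::metric_space" and f :: "'a \<Rightarrow> real"
  assumes S: "closed S" "continuous_on S f" "eventually (\<lambda>n. x n \<in> S) sequentially"
    and slow: "\<And>n. dist (x (Suc n)) (x n) \<le> L / (real n + 1)"
    and f0: "\<And>z. f z \<ge> 0"
    and sm: "summable (\<lambda>n. f (x n) / (real n + 1))"
    and y: "y \<in> limit_set x"
  shows "y \<in> S" "f y = 0"
proof -
  obtain r where r: "strict_mono r" "(x \<circ> r) \<longlonglongrightarrow> y"
    using y by (auto simp: limit_set_def)
  have rlim: "filterlim r sequentially sequentially"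
    using r(1) by (rule filterlim_subseq)
  have "eventually (\<lambda>k. (x \<circ> r) k \<in> S) sequentially"
    using rlim S(3) by (auto simp: filterlim_iff)
  with S(1) r(2) show yS: "y \<in> S"
    using Lim_in_closed_set[OF S(1) _ sequentially_bot r(2)] by blast
  show "f y = 0"
  proof (rule ccontr)
    assume "f y \<noteq> 0"
    with f0[of y] have fy: "f y > 0" by linarith
    obtain \<delta> where \<delta>: "\<delta> > 0" "\<And>z. z \<in> S \<Longrightarrow> dist z y < \<delta> \<Longrightarrow> dist (f z) (f y) < f y / 2"
      using S(2) yS fy unfolding continuous_on_iff by (metis half_gt_zero)
    have L0: "L \<ge> 0" using order_trans[OF zero_le_dist slow[of 0]] by simp
    \<comment> \<open>The second bound keeps the sequence within \<delta> / 2 of \<open>x m\<close>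
      along the window; the bound 1 keeps the indices of the window below 2 m. Using
      \<open>L + 1\<close> avoids dividing by 0.\<close>
    define \<eta> where "\<eta> = min 1 (\<delta> / (2 * (L + 1)))"
    have \<eta>: "\<eta> > 0" "\<eta> \<le> 1" using \<delta> L0 by (auto simp: \<eta>_def)
    have "L * \<eta> \<le> L * (\<delta> / (2 * (L + 1)))"
      using L0 by (intro mult_left_mono) (auto simp: \<eta>_def)
    also have "\<dots> \<le> \<delta> / 2" using L0 \<delta>(1) by (simp add: field_simps)
    finally have L\<eta>: "L * \<eta> \<le> \<delta> / 2" .
    \<comment> \<open>This is the harmonic mass found below: at least \<eta> m terms, each at least
      \<open>(f y / 2) / (3 * real m)\<close>.\<close>
    define e where "e = \<eta> * (f y / 2) / 3"
    have e: "e > 0" using \<eta> fy by (simp add: e_def)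
    obtain n0 where n0: "\<And>m n. m \<ge> n0 \<Longrightarrow> norm (sum (\<lambda>n. f (x n) / (real n + 1)) {m..<n}) < e"
      using sm e unfolding summable_Cauchy by blast
    obtain n1 where n1: "\<And>n. n \<ge> n1 \<Longrightarrow> x n \<in> S"
      using S(3) by (auto simp: eventually_sequentially)
    have "eventually (\<lambda>k. dist ((x \<circ> r) k) y < \<delta> / 2) sequentially"
      using tendstoD[OF r(2), of "\<delta> / 2"] \<delta>(1) by simp
    moreover have "eventually (\<lambda>k. r k \<ge> n0 + n1 + 1) sequentially"
      using rlim by (auto simp: filterlim_at_top)
    ultimately have "eventually (\<lambda>k. dist ((x \<circ> r) k) y < \<delta> / 2 \<and> r k \<ge> n0 + n1 + 1) sequentially"
      by (rule eventually_conj)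
    then obtain k where k: "dist (x (r k)) y < \<delta> / 2" "r k \<ge> n0 + n1 + 1"
      by (auto simp: eventually_sequentially)
    define m where "m = r k"
    have m: "m \<ge> n0" "m \<ge> n1" "m \<ge> 1" "dist (x m) y < \<delta> / 2" using k by (auto simp: m_def)
    \<comment> \<open>Rounding down costs nothing: the window has p + 1 \<ge> \<eta> m indices, but
      its last one is only p \<le> \<eta> m steps away from m.\<close>
    define p where "p = nat \<lfloor>\<eta> * real m\<rfloor>"
    have p: "real p \<le> \<eta> * real m" "\<eta> * real m \<le> real p + 1"
      using \<eta> by (auto simp: p_def)
    have walk: "dist (x (m + l)) (x m) \<le> real l * (L / (real m + 1))" for l
    proof (induction l)
      case (Suc l)
      have "dist (x (m + Suc l)) (x m) \<le> dist (x (Suc (m + l))) (x (m + l)) + dist (x (m + l)) (x m)"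
        using dist_triangle by simp
      also have "\<dots> \<le> L / (real (m + l) + 1) + real l * (L / (real m + 1))"
        by (intro add_mono slow Suc)
      also have "L / (real (m + l) + 1) \<le> L / (real m + 1)"
        using L0 by (intro divide_left_mono) auto
      finally show ?case by (simp add: algebra_simps add_divide_distrib)
    qed simp
    have lower: "f (x n) / (real n + 1) \<ge> (f y / 2) / (3 * real m)" if n: "n \<in> {m..<m + p + 1}" for n
    proof -
      obtain l where l: "n = m + l" "l \<le> p" using n that[of "n - m"] by auto
      have "real l \<le> \<eta> * real m" using l p by linarith
      then have "real l * (L / (real m + 1)) \<le> (\<eta> * real m) * (L / (real m + 1))"
        using L0 by (intro mult_right_mono) auto
      also have "\<dots> = (L * \<eta>) * (real m / (real m + 1))" by simp
      also have "\<dots> \<le> (L * \<eta>) * 1" using L0 \<eta> by (intro mult_left_mono) auto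
      finally have "dist (x n) (x m) \<le> \<delta> / 2" using walk[of l] L\<eta> l by simp
      then have "dist (x n) y < \<delta>" using m(4) dist_triangle[of "x n" y "x m"] by linarith
      with \<delta>(2) n1 n m have "dist (f (x n)) (f y) < f y / 2" by auto
      then have a: "f (x n) \<ge> f y / 2" by (auto simp: dist_real_def abs_if split: if_splits)
      have "\<eta> * real m \<le> 1 * real m" using \<eta> by (intro mult_right_mono) auto
      then have "real n + 1 \<le> 3 * real m" using m(3) l p by linarith
      then show ?thesis using a fy m(3) by (intro frac_le) auto
    qed
    have "e = (\<eta> * real m) * ((f y / 2) / (3 * real m))"
      using m(3) by (simp add: e_def)
    also have "\<dots> \<le> (real p + 1) * ((f y / 2) / (3 * real m))"
      using p fy by (intro mult_right_mono) auto
    also have "\<dots> = (\<Sum>n\<in>{m..<m + p + 1}. (f y / 2) / (3 * real m))" by simp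
    also have "\<dots> \<le> (\<Sum>n\<in>{m..<m + p + 1}. f (x n) / (real n + 1))"
      by (intro sum_mono lower)
    also have "\<dots> < e" using n0[OF m(1), of "m + p + 1"] by (simp add: abs_if split: if_splits)
    finally show False by simp
  qed
qed

section \<open>One step of the Lyapunov function\<close>

text \<open>With r the rate below, the conditional mean of the number of balls added to i is b i * r i,
  and N F_i = b i * (r i - N / T), where T is the total number of balls.\<close>
definition edge_rate :: "real \<Rightarrow> ('v \<Rightarrow> nat) \<Rightarrow> 'v \<Rightarrow> 'v \<Rightarrow> real" where
  "edge_rate \<alpha> b i j = real (b i) powr (\<alpha> - 1) / (real (b i) powr \<alpha> + real (b j) powr \<alpha>)"

definition rate :: "'v::finite set set \<Rightarrow> real \<Rightarrow> ('v \<Rightarrow> nat) \<Rightarrow> 'v \<Rightarrow> real" where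
  "rate E \<alpha> b i = (\<Sum>j | {i, j} \<in> E. edge_rate \<alpha> b i j)"

text \<open>The sum runs over ordered pairs, so every edge is counted twice.\<close>
definition potential :: "'v::finite set set \<Rightarrow> (nat \<Rightarrow> real) \<Rightarrow> ('v \<Rightarrow> nat) \<Rightarrow> real" where
  "potential E H b = (\<Sum>i\<in>UNIV. \<Sum>j | {i, j} \<in> E. ln (H (b i) + H (b j)))"

section \<open>Counting edges through their endpoints\<close>

lemma sum_neighbours_swap:
  fixes f :: "'v::finite \<Rightarrow> 'v \<Rightarrow> 'a::comm_monoid_add"
  shows "(\<Sum>i\<in>UNIV. \<Sum>j | {i, j} \<in> E. f j i) = (\<Sum>i\<in>UNIV. \<Sum>j | {i, j} \<in> E. f i j)"
proof -
  have "(\<Sum>i\<in>UNIV. \<Sum>j | {i, j} \<in> E. f j i) = (\<Sum>j\<in>UNIV. \<Sum>i | {i, j} \<in> E. f j i)"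
    using sum.swap_restrict[of UNIV UNIV "\<lambda>i j. f j i" "\<lambda>i j. {i, j} \<in> E"] by simp
  then show ?thesis by (simp add: insert_commute)
qed

lemma sum_incident_edges:
  fixes E :: "'v::finite set set"
  assumes "simple_graph E"
  shows "(\<Sum>e | e \<in> E \<and> i \<in> e. f e) = (\<Sum>j | {i, j} \<in> E. f {i, j})"
proof (rule sum.reindex_bij_betw[symmetric])
  show "bij_betw (\<lambda>j. {i, j}) {j. {i, j} \<in> E} {e \<in> E. i \<in> e}"
  proof (rule bij_betw_imageI)
    show "inj_on (\<lambda>j. {i, j}) {j. {i, j} \<in> E}"
      by (auto simp: inj_on_def doubleton_eq_iff)
    have "e \<in> (\<lambda>j. {i, j}) ` {j. {i, j} \<in> E}" if "e \<in> E" "i \<in> e" for e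
    proof -
      have "card e = 2" using assms that by (simp add: simple_graph_def)
      then obtain a b where "e = {a, b}" by (auto simp: card_2_iff)
      with that show ?thesis by (auto simp: insert_commute)
    qed
    then show "(\<lambda>j. {i, j}) ` {j. {i, j} \<in> E} = {e \<in> E. i \<in> e}" by auto
  qed
qed

lemma sum_degrees:
  fixes E :: "'v::finite set set"
  assumes "simple_graph E"
  shows "(\<Sum>i\<in>UNIV. card {j. {i, j} \<in> E}) = 2 * card E"
proof -
  have "(\<Sum>i\<in>UNIV. card {j. {i, j} \<in> E}) = (\<Sum>i\<in>UNIV. \<Sum>e | e \<in> E \<and> i \<in> e. 1)"
    by (simp only: sum_incident_edges[OF assms] card_eq_sum)
  also have "\<dots> = (\<Sum>e\<in>E. \<Sum>i | i \<in> UNIV \<and> i \<in> e. 1)"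
    by (rule sum.swap_restrict) auto
  also have "\<dots> = (\<Sum>e\<in>E. 2)"
    using assms by (intro sum.cong) (auto simp: simple_graph_def)
  finally show ?thesis by simp
qed

lemma card_neighbours_le:
  fixes E :: "'v::finite set set"
  assumes "simple_graph E"
  shows "card {j. {i, j} \<in> E} \<le> card E"
proof -
  have "card {j. {i, j} \<in> E} = card {e \<in> E. i \<in> e}"
    using sum_incident_edges[OF assms, of "\<lambda>_. 1::nat" i] by simp
  also have "\<dots> \<le> card E" by (intro card_mono) auto
  finally show ?thesis .
qed

section \<open>Rates and the increment of the potential\<close>

lemma edge_rate_nonneg: "edge_rate \<alpha> b i j \<ge> 0"
  by (simp add: edge_rate_def)

lemma rate_nonneg: "rate E \<alpha> b i \<ge> 0"
  by (simp add: rate_def sum_nonneg edge_rate_nonneg)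

lemma ball_times_edge_rate:
  assumes "b i \<ge> 1"
  shows "real (b i) * edge_rate \<alpha> b i j
    = real (b i) powr \<alpha> / (real (b i) powr \<alpha> + real (b j) powr \<alpha>)"
  using assms powr_mult_base[of "real (b i)" "\<alpha> - 1"] by (simp add: edge_rate_def)

text \<open>The two choice probabilities of an edge add up to 1. Adding the sum over ordered pairs
  to its mirror image therefore yields the sum of the degrees, 2 N.\<close>

lemma sum_ball_times_rate:
  fixes E :: "'v::finite set set"
  assumes "simple_graph E" and b: "\<And>i. b i \<ge> 1"
  shows "(\<Sum>i\<in>UNIV. real (b i) * rate E \<alpha> b i) = real (card E)"
proof -
  define q where "q = (\<lambda>i j. real (b i) powr \<alpha> / (real (b i) powr \<alpha> + real (b j) powr \<alpha>))"
  have q: "q i j + q j i = 1" for i j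
  proof -
    have "real (b i) powr \<alpha> > 0" "real (b j) powr \<alpha> > 0" using b[of i] b[of j] by auto
    then have "real (b i) powr \<alpha> + real (b j) powr \<alpha> \<noteq> 0" by linarith
    then show ?thesis
      by (simp add: q_def add.commute[of "real (b j) powr \<alpha>"] add_divide_distrib[symmetric])
  qed
  define X where "X = (\<Sum>i\<in>UNIV. \<Sum>j | {i, j} \<in> E. q i j)"
  have "X + X = (\<Sum>i\<in>UNIV. \<Sum>j | {i, j} \<in> E. q i j + q j i)"
    by (simp add: X_def sum.distrib sum_neighbours_swap[of q E])
  also have "\<dots> = real (\<Sum>i\<in>UNIV. card {j. {i, j} \<in> E})"
    by (simp add: q)
  also have "\<dots> = 2 * real (card E)"
    by (simp only: sum_degrees[OF assms(1)] of_nat_mult of_nat_numeral)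
  finally have "X = real (card E)" by simp
  then show ?thesis
    by (simp add: rate_def sum_distrib_left ball_times_edge_rate[where b = b, OF b] X_def q_def)
qed

text \<open>Let m be the larger of the two ball numbers. The denominator is at least
  \<open>m powr \<alpha>\<close>, and the numerator is at most \<open>m powr (\<alpha> - 1)\<close>
  if \<alpha> \<ge> 1 and at most 1 otherwise, because \<open>b i \<ge> 1\<close>. Finally m is at
  least half of the balls on the edge, so the rates decay uniformly in the configuration.\<close>

lemma edge_rate_le:
  assumes b: "\<And>i. b i \<ge> 1" and \<alpha>: "\<alpha> > 0" and n: "real n + 1 \<le> real (b i) + real (b j)"
  shows "edge_rate \<alpha> b i j \<le> ((real n + 1) / 2) powr (- min 1 \<alpha>)"
proof -
  define m where "m = max (real (b i)) (real (b j))"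
  have m: "m \<ge> 1" "m \<ge> (real n + 1) / 2" "real (b i) \<le> m"
    using n b[of i] by (auto simp: m_def)
  have "edge_rate \<alpha> b i j \<le> real (b i) powr (\<alpha> - 1) / m powr \<alpha>"
    unfolding edge_rate_def
    using b[of i] m by (intro divide_left_mono mult_pos_pos add_pos_nonneg) (auto simp: m_def max_def)
  also have "\<dots> \<le> m powr (max 1 \<alpha> - 1) / m powr \<alpha>"
  proof (intro divide_right_mono)
    show "real (b i) powr (\<alpha> - 1) \<le> m powr (max 1 \<alpha> - 1)"
    proof (cases "\<alpha> \<ge> 1")
      case True
      then show ?thesis using m by (simp add: max_absorb2 powr_mono2)
    next
      case False
      then have "real (b i) powr (\<alpha> - 1) \<le> real (b i) powr 0"
        using b[of i] by (intro powr_mono) auto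
      then show ?thesis using False b[of i] m by (auto simp: max_def)
    qed
  qed auto
  also have "\<dots> = m powr (- min 1 \<alpha>)"
    by (auto simp: powr_diff[symmetric] max_def min_def)
  also have "\<dots> \<le> ((real n + 1) / 2) powr (- min 1 \<alpha>)"
    using m \<alpha> by (intro powr_mono2') auto
  finally show ?thesis .
qed

lemma rate_le:
  fixes E :: "'v::finite set set"
  assumes "simple_graph E" "\<And>i. b i \<ge> 1" "\<alpha> > 0"
    and n: "\<And>i j. {i, j} \<in> E \<Longrightarrow> real n + 1 \<le> real (b i) + real (b j)"
  shows "rate E \<alpha> b i \<le> real (card E) * ((real n + 1) / 2) powr (- min 1 \<alpha>)"
proof -
  have "rate E \<alpha> b i \<le> (\<Sum>j | {i, j} \<in> E. ((real n + 1) / 2) powr (- min 1 \<alpha>))"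
    unfolding rate_def using assms by (intro sum_mono edge_rate_le) auto
  also have "\<dots> \<le> real (card E) * ((real n + 1) / 2) powr (- min 1 \<alpha>)"
    using card_neighbours_le[OF assms(1)] by (auto intro!: mult_right_mono)
  finally show ?thesis .
qed

text \<open>Each edge term grows by at least \<open>ln (1 + z)\<close>, z being its first order
  relative growth, and z - z^2 bounds this from below. The factors 2 and 4 come from the summation
  over ordered pairs and from (p + q)^2 \<le> 2 (p^2 + q^2).\<close>

lemma potential_step:
  fixes E :: "'v::finite set set" and b k :: "'v \<Rightarrow> nat"
  assumes \<alpha>: "\<alpha> > 0"
    and H: "\<And>b k. b \<ge> 1 \<Longrightarrow> k \<le> d \<Longrightarrow> H b + \<alpha> * (real k * real b powr (\<alpha> - 1)) \<le> H (b + k)"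
      "\<And>b. H b \<le> real b powr \<alpha>"
    and b: "\<And>i. b i \<ge> 1" and k: "\<And>i. k i \<le> d"
    and pos: "\<And>i j. {i, j} \<in> E \<Longrightarrow> H (b i) + H (b j) > 0"
  shows "potential E H b + 2 * \<alpha> * (\<Sum>i\<in>UNIV. real (k i) * rate E \<alpha> b i)
      - 4 * \<alpha>\<^sup>2 * real d * (\<Sum>i\<in>UNIV. real (k i) * (rate E \<alpha> b i)\<^sup>2)
    \<le> potential E H (\<lambda>i. b i + k i)"
proof -
  define p where "p = (\<lambda>i j. \<alpha> * (real (k i) * edge_rate \<alpha> b i j))"
  have p0: "p i j \<ge> 0" for i j using \<alpha> by (simp add: p_def edge_rate_nonneg)
  have edge: "ln (H (b i) + H (b j)) + ((p i j + p j i) - 2 * ((p i j)\<^sup>2 + (p j i)\<^sup>2))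
      \<le> ln (H (b i + k i) + H (b j + k j))" if e: "{i, j} \<in> E" for i j
  proof -
    define S where "S = real (b i) powr \<alpha> + real (b j) powr \<alpha>"
    define h where "h = H (b i) + H (b j)"
    have h: "0 < h" "h \<le> S" using pos[OF e] H(2)[of "b i"] H(2)[of "b j"] by (auto simp: h_def S_def)
    have pS: "(p i j + p j i) * S
        = \<alpha> * (real (k i) * real (b i) powr (\<alpha> - 1)) + \<alpha> * (real (k j) * real (b j) powr (\<alpha> - 1))"
    proof -
      have "S \<noteq> 0" using h by simp
      moreover have "edge_rate \<alpha> b i j = real (b i) powr (\<alpha> - 1) / S"
        "edge_rate \<alpha> b j i = real (b j) powr (\<alpha> - 1) / S"
        by (simp_all add: edge_rate_def S_def add.commute)
      ultimately show ?thesis by (simp add: p_def distrib_right)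
    qed
    \<comment> \<open>The growth is measured relative to S, the denominator of the rates, whereas
      the logarithm contains h. Since \<open>H\<close> lies below the power, h \<le> S, and the
      exchange goes in the right direction.\<close>
    have "h * (1 + (p i j + p j i)) \<le> h + (p i j + p j i) * S"
      using h p0[of i j] p0[of j i] mult_left_mono[of h S "p i j + p j i"] by (simp add: algebra_simps)
    also have "\<dots> \<le> H (b i + k i) + H (b j + k j)"
      using H(1)[of "b i" "k i"] H(1)[of "b j" "k j"] b k unfolding pS by (simp add: h_def)
    finally have "h * (1 + (p i j + p j i)) \<le> H (b i + k i) + H (b j + k j)" .
    moreover have "0 < h * (1 + (p i j + p j i))"
      using h p0[of i j] p0[of j i] by (intro mult_pos_pos) auto
    ultimately have "ln (h * (1 + (p i j + p j i))) \<le> ln (H (b i + k i) + H (b j + k j))"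
      by (subst ln_le_cancel_iff) auto
    moreover have "ln (h * (1 + (p i j + p j i))) = ln h + ln (1 + (p i j + p j i))"
      using h p0[of i j] p0[of j i] by (intro ln_mult_pos) auto
    moreover have "ln (1 + (p i j + p j i)) \<ge> (p i j + p j i) - (p i j + p j i)\<^sup>2"
      using p0[of i j] p0[of j i] by (intro ln_one_plus_ge) auto
    moreover have "(p i j + p j i)\<^sup>2 \<le> 2 * ((p i j)\<^sup>2 + (p j i)\<^sup>2)"
      using sum_squares_bound[of "p i j" "p j i"] by (simp add: power2_sum)
    ultimately show ?thesis by (simp add: h_def)
  qed
  have first: "(\<Sum>i\<in>UNIV. \<Sum>j | {i, j} \<in> E. p i j) = \<alpha> * (\<Sum>i\<in>UNIV. real (k i) * rate E \<alpha> b i)"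
    by (simp add: p_def rate_def sum_distrib_left)
  \<comment> \<open>Replacing the square of \<open>k i\<close> by \<open>d * k i\<close> keeps the
    error linear in \<open>k i\<close>, so that its expectation can be computed from the conditional
    mean of the gain.\<close>
  have second: "(\<Sum>i\<in>UNIV. \<Sum>j | {i, j} \<in> E. (p i j)\<^sup>2)
      \<le> \<alpha>\<^sup>2 * real d * (\<Sum>i\<in>UNIV. real (k i) * (rate E \<alpha> b i)\<^sup>2)"
  proof -
    have "(\<Sum>j | {i, j} \<in> E. (p i j)\<^sup>2) \<le> \<alpha>\<^sup>2 * real d * (real (k i) * (rate E \<alpha> b i)\<^sup>2)" for i
    proof -
      have "(\<Sum>j | {i, j} \<in> E. (p i j)\<^sup>2)
          = \<alpha>\<^sup>2 * (real (k i))\<^sup>2 * (\<Sum>j | {i, j} \<in> E. (edge_rate \<alpha> b i j)\<^sup>2)"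
        by (simp add: p_def sum_distrib_left power_mult_distrib mult_ac)
      also have "\<dots> \<le> \<alpha>\<^sup>2 * (real d * real (k i)) * (rate E \<alpha> b i)\<^sup>2"
      proof (intro mult_mono)
        show "(real (k i))\<^sup>2 \<le> real d * real (k i)"
          using k[of i] by (simp add: power2_eq_square mult_right_mono)
        show "(\<Sum>j | {i, j} \<in> E. (edge_rate \<alpha> b i j)\<^sup>2) \<le> (rate E \<alpha> b i)\<^sup>2"
          unfolding rate_def power2_eq_square sum_product
          by (intro sum_mono member_le_sum[of _ _ "\<lambda>j'. edge_rate \<alpha> b i _ * edge_rate \<alpha> b i j'"])
            (auto intro!: mult_nonneg_nonneg edge_rate_nonneg)
      qed (auto intro: sum_nonneg)
      finally show ?thesis by (simp add: mult_ac)
    qed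
    then show ?thesis by (simp add: sum_distrib_left sum_mono)
  qed
  have "potential E H (\<lambda>i. b i + k i) \<ge> (\<Sum>i\<in>UNIV. \<Sum>j | {i, j} \<in> E.
      ln (H (b i) + H (b j)) + ((p i j + p j i) - 2 * ((p i j)\<^sup>2 + (p j i)\<^sup>2)))"
    unfolding potential_def by (intro sum_mono) (use edge in auto)
  moreover have "(\<Sum>i\<in>UNIV. \<Sum>j | {i, j} \<in> E.
      ln (H (b i) + H (b j)) + ((p i j + p j i) - 2 * ((p i j)\<^sup>2 + (p j i)\<^sup>2)))
    = potential E H b + 2 * (\<Sum>i\<in>UNIV. \<Sum>j | {i, j} \<in> E. p i j)
      - 4 * (\<Sum>i\<in>UNIV. \<Sum>j | {i, j} \<in> E. (p i j)\<^sup>2)"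
    by (simp add: potential_def sum.distrib sum_subtractf sum_distrib_left[symmetric]
        sum_neighbours_swap[of p E] sum_neighbours_swap[of "\<lambda>i j. (p i j)\<^sup>2" E])
  ultimately show ?thesis using first second by simp
qed

text \<open>The cubic error is absorbed by the square when r > 2 a, and is of order a ^ 3 otherwise.\<close>
lemma drift_bound:
  fixes r a C :: real
  assumes "r \<ge> 0" "a \<ge> 0" "C \<ge> 0" "8 * C * r \<le> 1"
  shows "(r - a)\<^sup>2 / 2 - 8 * C * a ^ 3 \<le> (r - a)\<^sup>2 - C * r ^ 3"
proof (cases "r \<le> 2 * a")
  case True
  then have "C * r ^ 3 \<le> C * (2 * a) ^ 3"
    using assms by (intro mult_left_mono power_mono) auto
  moreover have "0 \<le> (r - a)\<^sup>2" by simp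
  moreover have "C * (2 * a) ^ 3 = 8 * C * a ^ 3" by (simp add: power_mult_distrib)
  ultimately show ?thesis by linarith
next
  case False
  \<comment> \<open>Half of (r - a)^2 is now at least r^2 / 8, and by
    \<open>8 * C * r \<le> 1\<close> this dominates C r^3.\<close>
  then have "(r / 2)\<^sup>2 \<le> (r - a)\<^sup>2"
    using assms by (intro power_mono) auto
  moreover have "(8 * C * r) * r\<^sup>2 \<le> 1 * r\<^sup>2"
    using assms by (intro mult_right_mono) auto
  moreover have "0 \<le> C * a ^ 3" using assms by simp
  ultimately show ?thesis by (simp add: power2_eq_square power3_eq_cube field_simps)
qed

text \<open>Since the weights \<open>b i\<close> sum to T and the weighted rates to N, the number N
  / T is the weighted mean of the rates. The squares about it sum to the weighted squares minus N^2
  / T, as for a variance; the rest is \<open>drift_bound\<close> summed with the weights.\<close>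

lemma total_drift_bound:
  fixes E :: "'v::finite set set"
  assumes E: "simple_graph E" and b: "\<And>i. b i \<ge> 1"
    and T: "T = (\<Sum>i\<in>UNIV. real (b i))" "T > 0" and C: "C \<ge> 0"
    and small: "\<And>i. 8 * C * rate E \<alpha> b i \<le> 1"
  shows "(\<Sum>i\<in>UNIV. real (b i) * (rate E \<alpha> b i - real (card E) / T)\<^sup>2) / 2
      \<le> (\<Sum>i\<in>UNIV. real (b i) * ((rate E \<alpha> b i)\<^sup>2 - C * (rate E \<alpha> b i) ^ 3))
        - (real (card E))\<^sup>2 / T + 8 * C * real (card E) ^ 3 / T\<^sup>2"
proof -
  define a where "a = real (card E) / T"
  have a0: "a \<ge> 0" using T(2) by (simp add: a_def)
  let ?r = "rate E \<alpha> b"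
  have "(\<Sum>i\<in>UNIV. real (b i) * (?r i - a)\<^sup>2) / 2 - 8 * C * a ^ 3 * T
      = (\<Sum>i\<in>UNIV. real (b i) * ((?r i - a)\<^sup>2 / 2 - 8 * C * a ^ 3))"
    by (simp add: T(1) right_diff_distrib sum_subtractf sum_distrib_left sum_distrib_right
        sum_divide_distrib mult_ac)
  also have "\<dots> \<le> (\<Sum>i\<in>UNIV. real (b i) * ((?r i - a)\<^sup>2 - C * ?r i ^ 3))"
    using a0 C small by (intro sum_mono mult_left_mono drift_bound rate_nonneg) auto
  also have "\<dots> = (\<Sum>i\<in>UNIV. real (b i) * ((?r i)\<^sup>2 - C * ?r i ^ 3))
      - 2 * a * (\<Sum>i\<in>UNIV. real (b i) * ?r i) + a\<^sup>2 * T"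
    by (simp add: T(1) power2_diff algebra_simps sum.distrib sum_subtractf sum_distrib_left)
  also have "\<dots> = (\<Sum>i\<in>UNIV. real (b i) * ((?r i)\<^sup>2 - C * ?r i ^ 3)) - (real (card E))\<^sup>2 / T"
    using T(2) by (simp add: sum_ball_times_rate[OF E b] a_def power2_eq_square field_simps)
  finally have "(\<Sum>i\<in>UNIV. real (b i) * (?r i - a)\<^sup>2) / 2 - 8 * C * a ^ 3 * T
      \<le> (\<Sum>i\<in>UNIV. real (b i) * ((?r i)\<^sup>2 - C * ?r i ^ 3)) - (real (card E))\<^sup>2 / T" .
  moreover have "8 * C * a ^ 3 * T = 8 * C * real (card E) ^ 3 / T\<^sup>2"
    using T(2) by (simp add: a_def power2_eq_square power3_eq_cube)
  ultimately show ?thesis unfolding a_def by linarith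
qed

section \<open>Summability criteria\<close>

lemma AE_summable_of_summable_expectation:
  fixes f :: "nat \<Rightarrow> 'a \<Rightarrow> real"
  assumes int: "\<And>n. integrable M (f n)" and nonneg: "\<And>n \<omega>. f n \<omega> \<ge> 0"
    and sm: "summable (\<lambda>n. \<integral>\<omega>. f n \<omega> \<partial>M)"
  shows "AE \<omega> in M. summable (\<lambda>n. f n \<omega>)"
proof -
  have [measurable]: "f n \<in> borel_measurable M" for n using int by auto
  have "(\<integral>\<^sup>+\<omega>. (\<Sum>n. ennreal (f n \<omega>)) \<partial>M) = (\<Sum>n. \<integral>\<^sup>+\<omega>. ennreal (f n \<omega>) \<partial>M)"
    by (intro nn_integral_suminf) auto
  also have "\<dots> = (\<Sum>n. ennreal (\<integral>\<omega>. f n \<omega> \<partial>M))"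
    using int nonneg by (simp add: nn_integral_eq_integral)
  also have "\<dots> = ennreal (\<Sum>n. \<integral>\<omega>. f n \<omega> \<partial>M)"
    using sm nonneg by (intro suminf_ennreal2) auto
  finally have "(\<integral>\<^sup>+\<omega>. (\<Sum>n. ennreal (f n \<omega>)) \<partial>M) \<noteq> \<infinity>" by simp
  then have "AE \<omega> in M. (\<Sum>n. ennreal (f n \<omega>)) \<noteq> \<infinity>"
    by (intro nn_integral_PInf_AE) auto
  then show ?thesis
    using nonneg by (auto intro: summable_suminf_not_top)
qed

lemma summable_of_telescoping_bound:
  fixes g v :: "nat \<Rightarrow> real"
  assumes "\<And>n. g n \<ge> 0" "\<And>n. n \<ge> n0 \<Longrightarrow> g n \<le> v (Suc n) - v n + s n"
    "summable s" "\<And>n. s n \<ge> 0" "\<And>n. n \<ge> n0 \<Longrightarrow> v n \<le> K"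
  shows "summable g"
proof -
  have "summable (\<lambda>n. g (n + n0))"
  proof (rule bounded_imp_summable)
    fix n
    have "(\<Sum>k\<le>n. g (k + n0)) \<le> v (Suc n + n0) - v n0 + (\<Sum>k\<le>n. s (k + n0))"
    proof (induction n)
      case 0
      then show ?case using assms(2)[of n0] by simp
    next
      case (Suc n)
      then show ?case using assms(2)[of "Suc n + n0"] by simp
    qed
    also have "(\<Sum>k\<le>n. s (k + n0)) = (\<Sum>k\<in>(\<lambda>k. k + n0) ` {..n}. s k)"
      by (simp add: sum.reindex)
    also have "\<dots> \<le> suminf s"
      using assms by (intro sum_le_suminf) auto
    finally show "(\<Sum>k\<le>n. g (k + n0)) \<le> K - v n0 + suminf s"
      using assms(5)[of "Suc n + n0"] by linarith
  qed (use assms in auto)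
  then show ?thesis by (simp add: summable_iff_shift)
qed

section \<open>The urn process\<close>

locale graph_urn = polya_urn M E \<alpha> B0 B C
  for M :: "'w measure" and E :: "'v::finite set set" and \<alpha> B0 B C +
  assumes graph: "simple_graph E" and edges: "card E \<ge> 1" and \<alpha>_pos: "\<alpha> > 0"
begin

section \<open>Ball numbers along a path\<close>

definition total :: "nat \<Rightarrow> real" where
  "total n = real (\<Sum>j\<in>UNIV. B0 j) + real n * real (card E)"

text \<open>The configuration is taken as a single random element: it lives in a countable type,
  where every real function is measurable.\<close>

definition state :: "nat \<Rightarrow> 'w \<Rightarrow> 'v \<Rightarrow> nat" where
  "state n \<omega> = (\<lambda>i. B n i \<omega>)"

definition gain :: "nat \<Rightarrow> 'w \<Rightarrow> 'v \<Rightarrow> nat" where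
  "gain n \<omega> = (\<lambda>i. card {e \<in> E. C n e \<omega> = i})"

lemma state_Suc: "\<omega> \<in> space M \<Longrightarrow> state (Suc n) \<omega> = (\<lambda>i. state n \<omega> i + gain n \<omega> i)"
  by (simp add: state_def gain_def step)

lemma state_pos: "\<omega> \<in> space M \<Longrightarrow> state n \<omega> i \<ge> 1"
proof (induction n)
  case 0
  then show ?case using initial_pos[of i] by (simp add: state_def initial)
qed (simp add: state_Suc)

lemma gain_le: "gain n \<omega> i \<le> card E"
  unfolding gain_def by (intro card_mono) auto

lemma gain_eq_sum:
  assumes "\<omega> \<in> space M"
  shows "gain n \<omega> i = (\<Sum>j | {i, j} \<in> E. of_bool (C n {i, j} \<omega> = i))"
proof -
  have "gain n \<omega> i = (\<Sum>e | e \<in> E \<and> C n e \<omega> = i. 1)" by (simp add: gain_def)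
  also have "\<dots> = (\<Sum>e | e \<in> E \<and> i \<in> e. of_bool (C n e \<omega> = i))"
    using choice_endpoint[OF _ assms, of _ n] by (intro sum.mono_neutral_cong_left) auto
  finally show ?thesis by (simp add: sum_incident_edges[OF graph])
qed

lemma sum_gain:
  assumes "\<omega> \<in> space M"
  shows "(\<Sum>i\<in>UNIV. gain n \<omega> i) = card E"
proof -
  have "(\<Sum>i\<in>UNIV. gain n \<omega> i) = (\<Sum>i\<in>UNIV. \<Sum>e | e \<in> E \<and> C n e \<omega> = i. 1)"
    by (simp add: gain_def)
  also have "\<dots> = (\<Sum>e\<in>E. \<Sum>i | i \<in> UNIV \<and> C n e \<omega> = i. 1)"
    by (rule sum.swap_restrict) auto
  finally show ?thesis by simp
qed

lemma sum_state:
  assumes "\<omega> \<in> space M"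
  shows "(\<Sum>i\<in>UNIV. real (state n \<omega> i)) = total n"
proof (induction n)
  case 0
  then show ?case using assms by (simp add: state_def initial total_def)
next
  case (Suc n)
  have "(\<Sum>i\<in>UNIV. real (gain n \<omega> i)) = real (card E)"
    using sum_gain[OF assms, of n] by (simp flip: of_nat_sum)
  with Suc show ?case by (simp add: state_Suc[OF assms] sum.distrib total_def algebra_simps)
qed

lemma total_ge: "real n + 1 \<le> total n" and total_Suc: "total (Suc n) = total n + real (card E)"
  and total_le: "total n \<le> (total 0 + real (card E)) * (real n + 1)"
proof -
  \<comment> \<open>Any vertex would serve here; \<open>undefined\<close> merely names one.\<close>
  have "1 \<le> B0 undefined" by (rule initial_pos)
  also have "\<dots> \<le> (\<Sum>j\<in>UNIV. B0 j)" by (rule member_le_sum) auto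
  finally have "(\<Sum>j\<in>UNIV. B0 j) \<ge> 1" .
  then have 1: "real (\<Sum>j\<in>UNIV. B0 j) \<ge> 1" by linarith
  have "real n * 1 \<le> real n * real (card E)" using edges by (intro mult_left_mono) auto
  with 1 show "real n + 1 \<le> total n" by (simp only: total_def)
  show "total (Suc n) = total n + real (card E)" by (simp add: total_def algebra_simps)
  show "total n \<le> (total 0 + real (card E)) * (real n + 1)"
    by (simp add: total_def algebra_simps sum_nonneg)
qed

lemma state_le_total:
  assumes "\<omega> \<in> space M"
  shows "real (state n \<omega> i) \<le> total n"
  unfolding sum_state[OF assms, symmetric] by (rule member_le_sum) auto

text \<open>Every step places the ball of the edge {i, j} itself on one of its two ends. This linear
  growth yields the decay of the rates, the positive arguments of the logarithms and the eventual
  membership in \<open>domain_\<Delta>\<close>.\<close>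

lemma edge_total:
  assumes "\<omega> \<in> space M" and e: "{i, j} \<in> E"
  shows "real n + 1 \<le> real (state n \<omega> i) + real (state n \<omega> j)"
proof -
  have "i \<noteq> j" using graph e by (auto simp: simple_graph_def)
  have grow: "gain n \<omega> i + gain n \<omega> j \<ge> 1" for n
  proof -
    have "C n {i, j} \<omega> = i \<or> C n {i, j} \<omega> = j"
      using choice_endpoint[OF e assms(1), of n] by auto
    then have "{i, j} \<in> {e \<in> E. C n e \<omega> = i} \<or> {i, j} \<in> {e \<in> E. C n e \<omega> = j}" using e by auto
    then show ?thesis unfolding gain_def
      by (metis (no_types, lifting) One_nat_def Suc_leI add_gr_0 card_gt_0_iff empty_iff finite)
  qed
  have "n + 1 \<le> state n \<omega> i + state n \<omega> j"
  proof (induction n)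
    case 0
    then show ?case using state_pos[OF assms(1), of 0 i] by simp
  next
    case (Suc n)
    then show ?case using grow[of n] by (simp add: state_Suc[OF assms(1)])
  qed
  then show ?thesis by linarith
qed

section \<open>Measurability and conditional means\<close>

lemma B_measurable: "B n i \<in> measurable M (count_space UNIV)"
proof (induction n)
  case 0
  have "B 0 i \<in> measurable M (count_space UNIV) \<longleftrightarrow> (\<lambda>_. B0 i) \<in> measurable M (count_space UNIV)"
    by (intro measurable_cong) (simp add: initial)
  then show ?case by simp
next
  case (Suc n)
  have "B (Suc n) i \<in> measurable M (count_space UNIV) \<longleftrightarrow>
    (\<lambda>\<omega>. B n i \<omega> + (\<Sum>e\<in>E. of_bool (C n e \<omega> = i))) \<in> measurable M (count_space UNIV)"
    by (intro measurable_cong) (simp add: step Int_def conj_commute)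
  moreover have "(\<lambda>\<omega>. B n i \<omega> + (\<Sum>e\<in>E. of_bool (C n e \<omega> = i))) \<in> measurable M (count_space UNIV)"
  proof -
    have "(\<lambda>\<omega>. of_bool (C n e \<omega> = i) :: nat) \<in> measurable M (count_space UNIV)" if "e \<in> E" for e
      by (rule measurable_compose[OF choice_measurable[OF that]]) simp
    with Suc show ?thesis by measurable
  qed
  ultimately show ?case by blast
qed

lemma subalgebra_history: "subalgebra M (history M B n)"
proof -
  have "{B k i -` A \<inter> space M | k i A. k \<le> n} \<subseteq> sets M"
    using measurable_sets[OF B_measurable] by auto
  then show ?thesis
    using sets.sigma_sets_subset[of _ M]
    by (auto simp: subalgebra_def history_def space_measure_of_conv sets_measure_of_conv)
qed

lemma state_measurable_history: "state n \<in> measurable (history M B n) (count_space UNIV)"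
proof -
  have sp: "space (history M B n) = space M" by (simp add: history_def space_measure_of_conv)
  have "state n -` {f} \<inter> space M \<in> sets (history M B n)" for f
  proof -
    have "B n i -` {f i} \<inter> space M \<in> sets (history M B n)" for i
      unfolding history_def by (subst sets_measure_of) (auto intro!: sigma_sets.Basic)
    then have "(\<Inter>i\<in>UNIV. B n i -` {f i} \<inter> space M) \<in> sets (history M B n)"
      by (intro sets.finite_INT) auto
    moreover have "(\<Inter>i\<in>UNIV. B n i -` {f i} \<inter> space M) = state n -` {f} \<inter> space M"
      by (auto simp: state_def)
    ultimately show ?thesis by simp
  qed
  then show ?thesis
    by (subst measurable_count_space_eq2_countable) (auto simp: sp)
qed

lemma history_function_measurable:
  fixes \<phi> :: "('v \<Rightarrow> nat) \<Rightarrow> real"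
  shows "(\<lambda>\<omega>. \<phi> (state n \<omega>)) \<in> borel_measurable (history M B n)"
  by (rule measurable_compose[OF state_measurable_history]) simp

text \<open>The total number of balls is deterministic, so the configuration stays in a finite box,
  on which any \<phi> is bounded.\<close>

lemma integrable_state:
  fixes \<phi> :: "('v \<Rightarrow> nat) \<Rightarrow> real"
  shows "integrable M (\<lambda>\<omega>. \<phi> (state n \<omega>))"
proof -
  let ?S = "Pi\<^sub>E UNIV (\<lambda>i::'v. {..nat \<lceil>total n\<rceil>})"
  have fin: "finite (insert 0 ((\<lambda>b. \<bar>\<phi> b\<bar>) ` ?S))"
    by (intro finite.insertI finite_imageI finite_PiE) auto
  have "AE \<omega> in M. norm (\<phi> (state n \<omega>)) \<le> Max (insert 0 ((\<lambda>b. \<bar>\<phi> b\<bar>) ` ?S))"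
  proof (rule AE_I2)
    fix \<omega> assume \<omega>: "\<omega> \<in> space M"
    have "state n \<omega> i \<le> nat \<lceil>total n\<rceil>" for i using state_le_total[OF \<omega>, of n i] by linarith
    then have "state n \<omega> \<in> ?S" by (simp add: PiE_def)
    then show "norm (\<phi> (state n \<omega>)) \<le> Max (insert 0 ((\<lambda>b. \<bar>\<phi> b\<bar>) ` ?S))"
      using fin by (intro Max_ge) auto
  qed
  moreover have "(\<lambda>\<omega>. \<phi> (state n \<omega>)) \<in> borel_measurable M"
    by (rule measurable_from_subalg[OF subalgebra_history history_function_measurable])
  ultimately show ?thesis by (rule integrable_const_bound)
qed

text \<open>The factor \<open>\<phi> (state n \<omega>)\<close> is measurable with respect to the
  history, so the indicator of the choice may be replaced by its conditional probability, which
  \<open>choice_prob\<close> identifies.\<close>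

lemma expectation_choice:
  fixes \<phi> :: "('v \<Rightarrow> nat) \<Rightarrow> real"
  assumes e: "{i, j} \<in> E"
  shows "integrable M (\<lambda>\<omega>. \<phi> (state n \<omega>) * of_bool (C n {i, j} \<omega> = i))"
    "(\<integral>\<omega>. \<phi> (state n \<omega>) * of_bool (C n {i, j} \<omega> = i) \<partial>M)
      = (\<integral>\<omega>. \<phi> (state n \<omega>) * (real (state n \<omega> i) * edge_rate \<alpha> (state n \<omega>) i j) \<partial>M)"
proof -
  interpret F: finite_measure_subalgebra M "history M B n"
    by (unfold_locales) (rule subalgebra_history)
  let ?A = "{\<omega> \<in> space M. C n {i, j} \<omega> = i}"
  have A: "?A \<in> sets M"
    using measurable_sets[OF choice_measurable[OF e], of "{i}" n] by (simp add: vimage_def Int_def conj_commute)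
  have eq: "\<phi> (state n \<omega>) * of_bool (C n {i, j} \<omega> = i) = \<phi> (state n \<omega>) * indicator ?A \<omega>"
    if "\<omega> \<in> space M" for \<omega>
    using that by simp
  have int: "integrable M (\<lambda>\<omega>. \<phi> (state n \<omega>) * indicator ?A \<omega>)"
    using integrable_mult_indicator[OF A integrable_state[of \<phi> n]] by (simp add: mult.commute)
  then show "integrable M (\<lambda>\<omega>. \<phi> (state n \<omega>) * of_bool (C n {i, j} \<omega> = i))"
    by (subst Bochner_Integration.integrable_cong[OF refl eq]) auto
  have "(\<integral>\<omega>. \<phi> (state n \<omega>) * of_bool (C n {i, j} \<omega> = i) \<partial>M)
      = (\<integral>\<omega>. \<phi> (state n \<omega>) * indicator ?A \<omega> \<partial>M)"
    by (rule Bochner_Integration.integral_cong[OF refl eq])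
  also have "\<dots> = (\<integral>\<omega>. \<phi> (state n \<omega>) * cprob M (history M B n) ?A \<omega> \<partial>M)"
    unfolding cprob_def
    by (rule F.real_cond_exp_intg(2)[symmetric]) (use int A history_function_measurable in auto)
  also have "\<dots> = (\<integral>\<omega>. \<phi> (state n \<omega>) * (real (state n \<omega> i) * edge_rate \<alpha> (state n \<omega>) i j) \<partial>M)"
  proof (rule integral_cong_AE)
    have bt: "real (state n \<omega> i) * edge_rate \<alpha> (state n \<omega>) i j
        = real (B n i \<omega>) powr \<alpha> / (real (B n i \<omega>) powr \<alpha> + real (B n j \<omega>) powr \<alpha>)"
      if "\<omega> \<in> space M" for \<omega>
      using ball_times_edge_rate[where b = "state n \<omega>", OF state_pos[OF that]] by (simp add: state_def)
    show "(\<lambda>\<omega>. \<phi> (state n \<omega>) * cprob M (history M B n) ?A \<omega>) \<in> borel_measurable M"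
      unfolding cprob_def
      using measurable_from_subalg[OF subalgebra_history history_function_measurable, of \<phi> n] by measurable
    show "(\<lambda>\<omega>. \<phi> (state n \<omega>) * (real (state n \<omega> i) * edge_rate \<alpha> (state n \<omega>) i j)) \<in> borel_measurable M"
      using measurable_from_subalg[OF subalgebra_history
          history_function_measurable[of "\<lambda>b. \<phi> b * (real (b i) * edge_rate \<alpha> b i j)" n]] .
    show "AE \<omega> in M. \<phi> (state n \<omega>) * cprob M (history M B n) ?A \<omega>
        = \<phi> (state n \<omega>) * (real (state n \<omega> i) * edge_rate \<alpha> (state n \<omega>) i j)"
      using choice_prob[OF e, of n] AE_space
      by eventually_elim (simp add: bt)
  qed
  finally show "(\<integral>\<omega>. \<phi> (state n \<omega>) * of_bool (C n {i, j} \<omega> = i) \<partial>M)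
      = (\<integral>\<omega>. \<phi> (state n \<omega>) * (real (state n \<omega> i) * edge_rate \<alpha> (state n \<omega>) i j) \<partial>M)" .
qed

lemma expectation_gain:
  fixes \<phi> :: "('v \<Rightarrow> nat) \<Rightarrow> real"
  shows "integrable M (\<lambda>\<omega>. real (gain n \<omega> i) * \<phi> (state n \<omega>))"
    "(\<integral>\<omega>. real (gain n \<omega> i) * \<phi> (state n \<omega>) \<partial>M)
      = (\<integral>\<omega>. real (state n \<omega> i) * rate E \<alpha> (state n \<omega>) i * \<phi> (state n \<omega>) \<partial>M)"
proof -
  have eq: "real (gain n \<omega> i) * \<phi> (state n \<omega>)
      = (\<Sum>j | {i, j} \<in> E. \<phi> (state n \<omega>) * of_bool (C n {i, j} \<omega> = i))" if "\<omega> \<in> space M" for \<omega>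
    by (simp only: gain_eq_sum[OF that] of_nat_sum of_nat_of_bool sum_distrib_left mult.commute)
  show "integrable M (\<lambda>\<omega>. real (gain n \<omega> i) * \<phi> (state n \<omega>))"
    by (rule iffD2[OF Bochner_Integration.integrable_cong[OF refl eq]])
      (auto intro!: Bochner_Integration.integrable_sum expectation_choice(1) simp del: sum_mult_of_bool_eq)
  have "(\<integral>\<omega>. real (gain n \<omega> i) * \<phi> (state n \<omega>) \<partial>M)
      = (\<integral>\<omega>. (\<Sum>j | {i, j} \<in> E. \<phi> (state n \<omega>) * of_bool (C n {i, j} \<omega> = i)) \<partial>M)"
    by (rule Bochner_Integration.integral_cong[OF refl eq])
  also have "\<dots> = (\<Sum>j | {i, j} \<in> E. \<integral>\<omega>. \<phi> (state n \<omega>) * of_bool (C n {i, j} \<omega> = i) \<partial>M)"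
    by (intro Bochner_Integration.integral_sum expectation_choice(1)) simp
  also have "\<dots> = (\<Sum>j | {i, j} \<in> E.
      \<integral>\<omega>. \<phi> (state n \<omega>) * (real (state n \<omega> i) * edge_rate \<alpha> (state n \<omega>) i j) \<partial>M)"
    by (intro sum.cong refl expectation_choice(2)) simp
  also have "\<dots> = (\<integral>\<omega>. (\<Sum>j | {i, j} \<in> E.
      \<phi> (state n \<omega>) * (real (state n \<omega> i) * edge_rate \<alpha> (state n \<omega>) i j)) \<partial>M)"
    by (intro Bochner_Integration.integral_sum[symmetric]
        integrable_state[of "\<lambda>b. \<phi> b * (real (b i) * edge_rate \<alpha> b i _)"])
  also have "\<dots> = (\<integral>\<omega>. real (state n \<omega> i) * rate E \<alpha> (state n \<omega>) i * \<phi> (state n \<omega>) \<partial>M)"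
    by (simp add: rate_def sum_distrib_left sum_distrib_right mult_ac)
  finally show "(\<integral>\<omega>. real (gain n \<omega> i) * \<phi> (state n \<omega>) \<partial>M)
      = (\<integral>\<omega>. real (state n \<omega> i) * rate E \<alpha> (state n \<omega>) i * \<phi> (state n \<omega>) \<partial>M)" .
qed

section \<open>Summability of the expected drift\<close>

text \<open>By \<open>field_F_proportions\<close> this equals N^2 / T times the sum of F_i^2 / x_i
  at the current proportions.\<close>

definition drift :: "nat \<Rightarrow> 'w \<Rightarrow> real" where
  "drift n \<omega> = (\<Sum>i\<in>UNIV. real (state n \<omega> i) * (rate E \<alpha> (state n \<omega>) i - real (card E) / total n)\<^sup>2)"

lemma drift_nonneg: "drift n \<omega> \<ge> 0"
  unfolding drift_def by (intro sum_nonneg) auto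

lemma integrable_drift: "integrable M (drift n)"
  unfolding drift_def
  using integrable_state[of "\<lambda>b. \<Sum>i\<in>UNIV. real (b i) * (rate E \<alpha> b i - real (card E) / total n)\<^sup>2" n] .

text \<open>Up to an additive constant, and with \<open>H\<close> in place of the power,
  \<open>v n\<close> is N times the expectation of L at the proportions: 2 \<alpha> removes the
  double count and the factor \<alpha>, while \<open>ln (total n)\<close> accounts for the
  normalisation of the ball numbers.\<close>

lemma expected_potential_step:
  assumes H: "\<And>b k. b \<ge> 1 \<Longrightarrow> k \<le> card E \<Longrightarrow> H b + \<alpha> * (real k * real b powr (\<alpha> - 1)) \<le> H (b + k)"
      "\<And>b. H b \<le> real b powr \<alpha>"
    and pos: "\<And>\<omega> i j. \<omega> \<in> space M \<Longrightarrow> {i, j} \<in> E \<Longrightarrow> H (state n \<omega> i) + H (state n \<omega> j) > 0"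
    and K: "K = 2 * \<alpha> * real (card E)"
    and small: "\<And>\<omega> i. \<omega> \<in> space M \<Longrightarrow> 8 * K * rate E \<alpha> (state n \<omega>) i \<le> 1"
    and v: "\<And>n. v n = (\<integral>\<omega>. potential E H (state n \<omega>) \<partial>M) / (2 * \<alpha>) - real (card E) * ln (total n)"
  shows "(\<integral>\<omega>. drift n \<omega> \<partial>M) / 2 \<le> v (Suc n) - v n + 8 * K * real (card E) ^ 3 / (real n + 1)\<^sup>2"
proof -
  let ?N = "real (card E)" and ?T = "total n"
  define r where "r = (\<lambda>\<omega>. rate E \<alpha> (state n \<omega>))"
  define Q where "Q = (\<lambda>\<omega>. \<Sum>i\<in>UNIV. real (state n \<omega> i) * ((r \<omega> i)\<^sup>2 - K * r \<omega> i ^ 3))"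
  define D where "D = (\<lambda>\<omega>. \<Sum>i\<in>UNIV. real (gain n \<omega> i) * (r \<omega> i - K * (r \<omega> i)\<^sup>2))"
  have K0: "K \<ge> 0" using \<alpha>_pos by (simp add: K)
  have T: "?T \<ge> real n + 1" "?T > 0" using total_ge[of n] by auto
  have gain_int: "integrable M (\<lambda>\<omega>. real (gain n \<omega> i) * (r \<omega> i - K * (r \<omega> i)\<^sup>2))" for i
    unfolding r_def
    by (rule expectation_gain(1)[of n i "\<lambda>b. rate E \<alpha> b i - K * (rate E \<alpha> b i)\<^sup>2"])
  have int_D: "integrable M D"
    unfolding D_def by (intro Bochner_Integration.integrable_sum gain_int)
  have int_Q: "integrable M Q"
    unfolding Q_def r_def
    by (rule integrable_state[of "\<lambda>b. \<Sum>i\<in>UNIV. real (b i) * ((rate E \<alpha> b i)\<^sup>2 - K * rate E \<alpha> b i ^ 3)"])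
  have int_i: "integrable M (\<lambda>\<omega>. real (state n \<omega> i) * ((r \<omega> i)\<^sup>2 - K * r \<omega> i ^ 3))" for i
    unfolding r_def
    by (rule integrable_state[of "\<lambda>b. real (b i) * ((rate E \<alpha> b i)\<^sup>2 - K * rate E \<alpha> b i ^ 3)"])
  \<comment> \<open>In the mean the gain at i becomes \<open>b i * r i\<close>, which raises every
    power of the rate by one.\<close>
  have "(\<integral>\<omega>. D \<omega> \<partial>M) = (\<Sum>i\<in>UNIV. \<integral>\<omega>. real (gain n \<omega> i) * (r \<omega> i - K * (r \<omega> i)\<^sup>2) \<partial>M)"
    unfolding D_def by (intro Bochner_Integration.integral_sum gain_int)
  also have "\<dots> = (\<Sum>i\<in>UNIV. \<integral>\<omega>. real (state n \<omega> i) * r \<omega> i * (r \<omega> i - K * (r \<omega> i)\<^sup>2) \<partial>M)"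
    unfolding r_def
    by (intro sum.cong refl expectation_gain(2)[of n _ "\<lambda>b. rate E \<alpha> b _ - K * (rate E \<alpha> b _)\<^sup>2"])
  also have "\<dots> = (\<Sum>i\<in>UNIV. \<integral>\<omega>. real (state n \<omega> i) * ((r \<omega> i)\<^sup>2 - K * r \<omega> i ^ 3) \<partial>M)"
    by (simp add: power2_eq_square power3_eq_cube algebra_simps)
  also have "\<dots> = (\<integral>\<omega>. Q \<omega> \<partial>M)"
    unfolding Q_def by (intro Bochner_Integration.integral_sum[symmetric] int_i)
  finally have DQ: "(\<integral>\<omega>. D \<omega> \<partial>M) = (\<integral>\<omega>. Q \<omega> \<partial>M)" .
  \<comment> \<open>The second order coefficient 4 \<alpha>^2 d with d = N equals 2 \<alpha> K,
    whence the value of \<open>K\<close>.\<close>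
  have step: "potential E H (state n \<omega>) + 2 * \<alpha> * D \<omega> \<le> potential E H (state (Suc n) \<omega>)"
    if \<omega>: "\<omega> \<in> space M" for \<omega>
    using potential_step[where b = "state n \<omega>" and k = "gain n \<omega>" and E = E and d = "card E", OF \<alpha>_pos H] \<omega> pos[OF \<omega>] state_pos[OF \<omega>] gain_le[of n \<omega>]
    by (simp add: state_Suc[OF \<omega>] D_def r_def K right_diff_distrib sum_subtractf sum_distrib_left
        power2_eq_square mult_ac)
  have "(\<integral>\<omega>. potential E H (state n \<omega>) + 2 * \<alpha> * D \<omega> \<partial>M) \<le> (\<integral>\<omega>. potential E H (state (Suc n) \<omega>) \<partial>M)"
    by (intro integral_mono Bochner_Integration.integrable_add integrable_mult_right integrable_state int_D step)
  then have "(\<integral>\<omega>. potential E H (state n \<omega>) \<partial>M) + 2 * \<alpha> * (\<integral>\<omega>. Q \<omega> \<partial>M)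
      \<le> (\<integral>\<omega>. potential E H (state (Suc n) \<omega>) \<partial>M)"
    by (simp add: integrable_state int_D DQ)
  then have "((\<integral>\<omega>. potential E H (state n \<omega>) \<partial>M) + 2 * \<alpha> * (\<integral>\<omega>. Q \<omega> \<partial>M)) / (2 * \<alpha>)
      \<le> (\<integral>\<omega>. potential E H (state (Suc n) \<omega>) \<partial>M) / (2 * \<alpha>)"
    using \<alpha>_pos by (intro divide_right_mono) auto
  then have 1: "(\<integral>\<omega>. potential E H (state n \<omega>) \<partial>M) / (2 * \<alpha>) + (\<integral>\<omega>. Q \<omega> \<partial>M)
      \<le> (\<integral>\<omega>. potential E H (state (Suc n) \<omega>) \<partial>M) / (2 * \<alpha>)"
    using \<alpha>_pos by (simp add: add_divide_distrib)
  \<comment> \<open>The growth of N ln T is at most N^2 / T, the very amount subtracted in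
    \<open>total_drift_bound\<close>.\<close>
  have "ln (?T + ?N) - ln ?T = ln (1 + ?N / ?T)"
  proof -
    have "1 + ?N / ?T = (?T + ?N) / ?T" using T by (simp add: add_divide_distrib)
    moreover have "?T + ?N \<noteq> 0" using T by linarith
    ultimately show ?thesis using T by (simp add: ln_div)
  qed
  also have "\<dots> \<le> ?N / ?T" using T by (intro ln_add_one_self_le_self) auto
  finally have "?N * (ln (?T + ?N) - ln ?T) \<le> ?N * (?N / ?T)" by (intro mult_left_mono) auto
  then have 2: "?N * ln (total (Suc n)) - ?N * ln ?T \<le> ?N\<^sup>2 / ?T"
    by (simp add: total_Suc power2_eq_square right_diff_distrib)
  have "(\<integral>\<omega>. drift n \<omega> / 2 \<partial>M) \<le> (\<integral>\<omega>. Q \<omega> - (?N\<^sup>2 / ?T - 8 * K * ?N ^ 3 / ?T\<^sup>2) \<partial>M)"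
  proof (intro integral_mono Bochner_Integration.integrable_diff int_Q integrable_divide integrable_drift)
    fix \<omega> assume \<omega>: "\<omega> \<in> space M"
    show "drift n \<omega> / 2 \<le> Q \<omega> - (?N\<^sup>2 / ?T - 8 * K * ?N ^ 3 / ?T\<^sup>2)"
      using total_drift_bound[OF graph state_pos[OF \<omega>] sum_state[OF \<omega>, symmetric] T(2) K0 small[OF \<omega>]]
      by (simp add: drift_def Q_def r_def)
  qed auto
  also have "\<dots> = (\<integral>\<omega>. Q \<omega> \<partial>M) - (?N\<^sup>2 / ?T - 8 * K * ?N ^ 3 / ?T\<^sup>2)"
    by (simp add: int_Q prob_space)
  finally have 3: "(\<integral>\<omega>. drift n \<omega> \<partial>M) / 2 \<le> (\<integral>\<omega>. Q \<omega> \<partial>M) - ?N\<^sup>2 / ?T + 8 * K * ?N ^ 3 / ?T\<^sup>2"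
    by simp
  have "8 * K * ?N ^ 3 / ?T\<^sup>2 \<le> 8 * K * ?N ^ 3 / (real n + 1)\<^sup>2"
    using T K0 by (intro divide_left_mono power_mono mult_pos_pos) auto
  with 1 2 3 show ?thesis by (simp add: v)
qed

lemma summable_expected_drift: "summable (\<lambda>n. \<integral>\<omega>. drift n \<omega> \<partial>M)"
proof -
  let ?N = "real (card E)"
  obtain H c where H: "\<And>b k. b \<ge> 1 \<Longrightarrow> k \<le> card E \<Longrightarrow> H b + \<alpha> * (real k * real b powr (\<alpha> - 1)) \<le> H (b + k)"
      "\<And>b. b \<ge> 1 \<Longrightarrow> real b powr \<alpha> - c \<le> H b" "\<And>b. H b \<le> real b powr \<alpha>"
    using superlinear_increment_powr[OF \<alpha>_pos, of "card E"] by blast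
  define K where "K = 2 * \<alpha> * ?N"
  have K0: "K \<ge> 0" using \<alpha>_pos by (simp add: K_def)
  define v where "v = (\<lambda>n. (\<integral>\<omega>. potential E H (state n \<omega>) \<partial>M) / (2 * \<alpha>) - ?N * ln (total n))"
  have half: "filterlim (\<lambda>n. (real n + 1) / 2) at_top sequentially"
    by (rule filterlim_at_top_mono[OF
          filterlim_tendsto_pos_mult_at_top[OF tendsto_const, of "1/2", OF _ filterlim_real_sequentially]]) auto
  \<comment> \<open>Two thresholds are met from some n0 on. This one makes 8 K times any rate at
    most 8 K N / (8 K N + 1); the next makes the powers on an edge exceed 2 |c|, the most that two
    corrections in \<open>H\<close> can take away.\<close>
  have "eventually (\<lambda>n. ((real n + 1) / 2) powr (- min 1 \<alpha>) < 1 / (8 * K * ?N + 1)) sequentially"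
    using tendsto_neg_powr[OF _ half, of "- min 1 \<alpha>"] \<alpha>_pos K0
    by (intro order_tendstoD(2)) (auto simp: min_def intro!: add_nonneg_pos mult_nonneg_nonneg)
  moreover have "eventually (\<lambda>n. ((real n + 1) / 2) powr (- \<alpha>) < 1 / (2 * \<bar>c\<bar> + 1)) sequentially"
    using tendsto_neg_powr[OF _ half, of "- \<alpha>"] \<alpha>_pos by (intro order_tendstoD(2)) auto
  ultimately have "eventually (\<lambda>n. ((real n + 1) / 2) powr (- min 1 \<alpha>) < 1 / (8 * K * ?N + 1)
      \<and> ((real n + 1) / 2) powr (- \<alpha>) < 1 / (2 * \<bar>c\<bar> + 1)) sequentially"
    by (rule eventually_conj)
  then obtain n0 where n0:
    "\<And>n. n \<ge> n0 \<Longrightarrow> ((real n + 1) / 2) powr (- min 1 \<alpha>) < 1 / (8 * K * ?N + 1)"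
    "\<And>n. n \<ge> n0 \<Longrightarrow> ((real n + 1) / 2) powr (- \<alpha>) < 1 / (2 * \<bar>c\<bar> + 1)"
    unfolding eventually_sequentially by blast
  have small: "8 * K * rate E \<alpha> (state n \<omega>) i \<le> 1" if "n \<ge> n0" "\<omega> \<in> space M" for n \<omega> i
  proof -
    have "rate E \<alpha> (state n \<omega>) i \<le> ?N * ((real n + 1) / 2) powr (- min 1 \<alpha>)"
      using that by (intro rate_le graph state_pos \<alpha>_pos edge_total)
    also have "\<dots> \<le> ?N * (1 / (8 * K * ?N + 1))"
      using n0(1)[OF that(1)] by (intro mult_left_mono) auto
    finally have "8 * K * rate E \<alpha> (state n \<omega>) i \<le> 8 * K * (?N * (1 / (8 * K * ?N + 1)))"
      using K0 by (intro mult_left_mono) auto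
    also have "\<dots> = (8 * K * ?N) / (8 * K * ?N + 1)" by simp
    also have "\<dots> \<le> 1" using K0 by (subst divide_le_eq_1_pos) (auto intro!: add_nonneg_pos mult_nonneg_nonneg)
    finally show ?thesis .
  qed
  have pos: "H (state n \<omega> i) + H (state n \<omega> j) > 0"
    if n: "n \<ge> n0" and \<omega>: "\<omega> \<in> space M" and e: "{i, j} \<in> E" for n \<omega> i j
  proof -
    let ?h = "(real n + 1) / 2"
    have hp: "?h powr \<alpha> > 0" by simp
    have "1 / ?h powr \<alpha> < 1 / (2 * \<bar>c\<bar> + 1)"
      using n0(2)[OF n] by (simp add: powr_minus_divide)
    then have "2 * \<bar>c\<bar> + 1 < ?h powr \<alpha>"
      using hp by (simp add: field_simps)
    moreover have "?h powr \<alpha> \<le> real (state n \<omega> i) powr \<alpha> + real (state n \<omega> j) powr \<alpha>"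
    proof -
      \<comment> \<open>One end of the edge carries at least half of its balls.\<close>
      have "?h \<le> real (state n \<omega> i) \<or> ?h \<le> real (state n \<omega> j)"
        using edge_total[OF \<omega> e, of n] by (simp add: field_simps) linarith
      then have "?h powr \<alpha> \<le> real (state n \<omega> i) powr \<alpha> \<or> ?h powr \<alpha> \<le> real (state n \<omega> j) powr \<alpha>"
        using \<alpha>_pos by (auto intro!: powr_mono2)
      then show ?thesis
        using powr_ge_zero[of "real (state n \<omega> i)" \<alpha>] powr_ge_zero[of "real (state n \<omega> j)" \<alpha>] by linarith
    qed
    ultimately show ?thesis
      using H(2)[OF state_pos[OF \<omega>], of n i] H(2)[OF state_pos[OF \<omega>], of n j] by linarith
  qed
  \<comment> \<open>No ball number exceeds \<open>total n\<close>, so the potential is at most 2 N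
    (ln 2 + \<alpha> ln T); after division by 2 \<alpha>, the growing part is cancelled by the
    second term of \<open>v\<close>.\<close>
  have bound: "v n \<le> ?N * ln 2 / \<alpha>" if n: "n \<ge> n0" for n
  proof -
    have T: "total n > 0" using total_ge[of n] by linarith
    have "potential E H (state n \<omega>) \<le> 2 * ?N * (ln 2 + \<alpha> * ln (total n))" if \<omega>: "\<omega> \<in> space M" for \<omega>
    proof -
      have "ln (H (state n \<omega> i) + H (state n \<omega> j)) \<le> ln 2 + \<alpha> * ln (total n)" if e: "{i, j} \<in> E" for i j
      proof -
        have "H (state n \<omega> i) \<le> total n powr \<alpha>" for i
          using H(3)[of "state n \<omega> i"] powr_mono2[OF less_imp_le[OF \<alpha>_pos] _ state_le_total[OF \<omega>, of n i]]
          by simp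
        then have "H (state n \<omega> i) + H (state n \<omega> j) \<le> 2 * total n powr \<alpha>"
          by (smt (verit))
        then have "ln (H (state n \<omega> i) + H (state n \<omega> j)) \<le> ln (2 * total n powr \<alpha>)"
          using pos[OF n \<omega> e] T by (subst ln_le_cancel_iff) auto
        also have "\<dots> = ln 2 + \<alpha> * ln (total n)" using T by (simp add: ln_mult ln_powr)
        finally show ?thesis .
      qed
      then have "potential E H (state n \<omega>) \<le> (\<Sum>i\<in>UNIV. \<Sum>j | {i, j} \<in> E. ln 2 + \<alpha> * ln (total n))"
        unfolding potential_def by (intro sum_mono) auto
      also have "\<dots> = real (\<Sum>i\<in>UNIV. card {j. {i, j} \<in> E}) * (ln 2 + \<alpha> * ln (total n))"
        by (simp add: sum_distrib_right)
      finally show ?thesis by (simp only: sum_degrees[OF graph] of_nat_mult of_nat_numeral)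
    qed
    then have "(\<integral>\<omega>. potential E H (state n \<omega>) \<partial>M) \<le> (\<integral>\<omega>. 2 * ?N * (ln 2 + \<alpha> * ln (total n)) \<partial>M)"
      by (intro integral_mono integrable_state) auto
    also have "\<dots> = 2 * ?N * (ln 2 + \<alpha> * ln (total n))" by (simp add: prob_space)
    finally have "(\<integral>\<omega>. potential E H (state n \<omega>) \<partial>M) / (2 * \<alpha>)
        \<le> 2 * ?N * (ln 2 + \<alpha> * ln (total n)) / (2 * \<alpha>)"
      using \<alpha>_pos by (intro divide_right_mono) auto
    also have "\<dots> = ?N * ln 2 / \<alpha> + ?N * ln (total n)"
      using \<alpha>_pos by (simp add: field_simps)
    finally show ?thesis by (simp add: v_def)
  qed
  have "summable (\<lambda>n. (\<integral>\<omega>. drift n \<omega> \<partial>M) / 2)"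
  proof (rule summable_of_telescoping_bound)
    show "(\<integral>\<omega>. drift n \<omega> \<partial>M) / 2 \<ge> 0" for n by (simp add: drift_nonneg)
    show "(\<integral>\<omega>. drift n \<omega> \<partial>M) / 2 \<le> v (Suc n) - v n + 8 * K * ?N ^ 3 / (real n + 1)\<^sup>2"
      if "n \<ge> n0" for n
      using pos[OF that] small[OF that] by (intro expected_potential_step[OF H(1,3)]) (auto simp: K_def v_def)
    show "summable (\<lambda>n. 8 * K * ?N ^ 3 / (real n + 1)\<^sup>2)"
    proof -
      have "summable (\<lambda>n. inverse ((real (Suc n))\<^sup>2))"
        using inverse_power_summable[of 2, where 'a = real]
        by (subst summable_Suc_iff[of "\<lambda>n. inverse ((real n)\<^sup>2)"]) (simp add: power_inverse)
      from summable_mult[OF this, of "8 * K * ?N ^ 3"] show ?thesis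
        by (simp add: divide_inverse add.commute)
    qed
  qed (use bound K0 in auto)
  then show ?thesis by (simp add: summable_divide_iff)
qed

lemma AE_summable_drift: "AE \<omega> in M. summable (\<lambda>n. drift n \<omega>)"
  by (intro AE_summable_of_summable_expectation integrable_drift drift_nonneg summable_expected_drift)

section \<open>From ball numbers back to proportions\<close>

lemma proportions_nth: "proportions E B0 B \<omega> n $ i = real (state n \<omega> i) / total n"
  by (simp add: proportions_def state_def total_def)

text \<open>The choice probabilities are homogeneous of degree 0, so the normalisation by
  \<open>total n\<close> cancels in them.\<close>

lemma field_F_proportions:
  assumes \<omega>: "\<omega> \<in> space M"
  shows "real (card E) * field_F E \<alpha> (proportions E B0 B \<omega> n) $ i
    = real (state n \<omega> i) * (rate E \<alpha> (state n \<omega>) i - real (card E) / total n)"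
proof -
  have T: "total n > 0" using total_ge[of n] by linarith
  have "(s / total n) powr \<alpha> / ((s / total n) powr \<alpha> + (t / total n) powr \<alpha>)
      = s powr \<alpha> / (s powr \<alpha> + t powr \<alpha>)" if "s \<ge> 0" "t \<ge> 0" for s t
    using that T by (simp add: powr_divide add_divide_distrib[symmetric])
  then have "field_F E \<alpha> (proportions E B0 B \<omega> n) $ i
      = - (real (state n \<omega> i) / total n) + 1 / real (card E) * (real (state n \<omega> i) * rate E \<alpha> (state n \<omega>) i)"
    by (simp add: field_F_def proportions_nth rate_def sum_distrib_left
        ball_times_edge_rate[where b = "state n \<omega>", OF state_pos[OF \<omega>]])
  moreover have "E \<noteq> {}" using edges by auto
  ultimately show ?thesis by (simp add: distrib_left right_diff_distrib)
qed

text \<open>The square of N F_i is \<open>b i\<close> times one summand of the drift. Bounding that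
  factor by \<open>total n\<close>, which is of order n + 1, produces the harmonic weight.\<close>

lemma field_F_le_drift:
  assumes \<omega>: "\<omega> \<in> space M"
  shows "(field_F E \<alpha> (proportions E B0 B \<omega> n) $ i)\<^sup>2 / (real n + 1) \<le> (total 0 + real (card E)) * drift n \<omega>"
proof -
  let ?F = "field_F E \<alpha> (proportions E B0 B \<omega> n) $ i"
  let ?g = "rate E \<alpha> (state n \<omega>) i - real (card E) / total n"
  have T: "total n \<ge> 0" using total_ge[of n] by linarith
  have "1 * \<bar>?F\<bar> \<le> real (card E) * \<bar>?F\<bar>" using edges by (intro mult_right_mono) auto
  then have "\<bar>?F\<bar> \<le> \<bar>real (card E) * ?F\<bar>" by (simp add: abs_mult)
  then have "?F\<^sup>2 \<le> (real (card E) * ?F)\<^sup>2" by (simp only: abs_le_square_iff)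
  also have "\<dots> = real (state n \<omega> i) * (real (state n \<omega> i) * ?g\<^sup>2)"
    by (simp add: field_F_proportions[OF \<omega>] power_mult_distrib power2_eq_square[of "real _"])
  also have "\<dots> \<le> total n * drift n \<omega>"
  proof (intro mult_mono state_le_total \<omega> T)
    show "real (state n \<omega> i) * ?g\<^sup>2 \<le> drift n \<omega>"
      unfolding drift_def by (rule member_le_sum[of i UNIV]) auto
  qed auto
  also have "\<dots> \<le> ((total 0 + real (card E)) * (real n + 1)) * drift n \<omega>"
    by (intro mult_right_mono total_le drift_nonneg)
  finally show ?thesis by (simp add: divide_le_eq algebra_simps)
qed

text \<open>A coordinate changes by (k T - b N) / (T (T + N)), where both products lie between 0 and
  N T. The number of vertices enters by passing to the l1 norm.\<close>

lemma proportions_slow: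
  assumes \<omega>: "\<omega> \<in> space M"
  shows "dist (proportions E B0 B \<omega> (Suc n)) (proportions E B0 B \<omega> n) \<le> real CARD('v) / (real n + 1)"
proof -
  let ?x = "proportions E B0 B \<omega>" and ?T = "total n" and ?N = "real (card E)"
  have T: "?T \<ge> real n + 1" "?T > 0" using total_ge[of n] by auto
  have N: "?N \<ge> 1" using edges by simp
  have "\<bar>(?x (Suc n) - ?x n) $ i\<bar> \<le> 1 / (real n + 1)" for i
  proof -
    let ?b = "real (state n \<omega> i)" and ?k = "real (gain n \<omega> i)"
    have b: "0 \<le> ?b" "?b \<le> ?T" using state_le_total[OF \<omega>] by auto
    have k: "0 \<le> ?k" "?k \<le> ?N" using gain_le by auto
    have eq: "(?x (Suc n) - ?x n) $ i = (?k * ?T - ?b * ?N) / (?T * (?T + ?N))"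
      using T N by (simp add: proportions_nth state_Suc[OF \<omega>] total_Suc divide_simps) (simp add: algebra_simps)
    have le: "\<bar>?k * ?T - ?b * ?N\<bar> \<le> ?N * ?T"
    proof -
      have "?k * ?T \<le> ?N * ?T" "?b * ?N \<le> ?T * ?N" "0 \<le> ?k * ?T" "0 \<le> ?b * ?N"
        using b k T by (auto intro: mult_right_mono)
      then show ?thesis by (simp only: mult.commute[of ?T ?N] abs_le_iff) linarith
    qed
    have "\<bar>(?x (Suc n) - ?x n) $ i\<bar> = \<bar>?k * ?T - ?b * ?N\<bar> / (?T * (?T + ?N))"
      unfolding eq using T N by (simp add: abs_mult)
    also have "\<dots> \<le> (?N * ?T) / (?T * (?T + ?N))"
      using le T N by (intro divide_right_mono) auto
    also have "\<dots> = ?N / (?T + ?N)" using T by simp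
    also have "\<dots> \<le> 1 / (real n + 1)"
    proof -
      have "?N * (real n + 1) \<le> ?T + ?N"
        by (simp add: total_def algebra_simps sum_nonneg)
      then show ?thesis using T N by (simp add: divide_simps)
    qed
    finally show ?thesis .
  qed
  then have "(\<Sum>i\<in>UNIV. \<bar>(?x (Suc n) - ?x n) $ i\<bar>) \<le> (\<Sum>i\<in>(UNIV::'v set). 1 / (real n + 1))"
    by (intro sum_mono)
  with norm_le_l1_cart[of "?x (Suc n) - ?x n"] show ?thesis by (simp add: dist_norm)
qed

lemma eventually_proportions_domain:
  assumes \<omega>: "\<omega> \<in> space M" and c: "0 < c" "c < 1 / real (card E)"
  shows "eventually (\<lambda>n. proportions E B0 B \<omega> n \<in> domain_\<Delta> E c) sequentially"
proof -
  have cN: "1 - c * real (card E) > 0" using c edges by (simp add: field_simps)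
  \<comment> \<open>From this index on c T = c (T_0 + n N) \<le> n, where T_0 is
    \<open>total 0\<close>; such an index exists because c N < 1.\<close>
  obtain n0 where n0: "real n0 \<ge> c * total 0 / (1 - c * real (card E))"
    using real_arch_simple by blast
  have "proportions E B0 B \<omega> n \<in> domain_\<Delta> E c" if n: "n \<ge> n0" for n
  proof -
    have T: "total n > 0" using total_ge[of n] by linarith
    have "c * total 0 \<le> real n0 * (1 - c * real (card E))"
      using n0 cN by (simp add: divide_le_eq)
    also have "\<dots> \<le> real n * (1 - c * real (card E))" using n cN by (intro mult_right_mono) auto
    finally have "c * total n \<le> real n + 1" by (simp add: total_def algebra_simps)
    then have "c \<le> real (state n \<omega> i) / total n + real (state n \<omega> j) / total n" if "{i, j} \<in> E" for i j
      using edge_total[OF \<omega> that, of n] T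
      by (simp add: add_divide_distrib[symmetric] pos_le_divide_eq)
    moreover have "(\<Sum>i\<in>UNIV. real (state n \<omega> i) / total n) = 1"
      using T by (simp add: sum_divide_distrib[symmetric] sum_state[OF \<omega>])
    ultimately show ?thesis using T by (simp add: domain_\<Delta>_def proportions_nth)
  qed
  then show ?thesis by (auto simp: eventually_sequentially)
qed

end

section \<open>Convergence to equilibria\<close>

lemma closed_domain_\<Delta>: "closed (domain_\<Delta> E c)"
  unfolding domain_\<Delta>_def
  by (intro closed_Collect_conj closed_Collect_all closed_Collect_imp closed_Collect_le
      closed_Collect_eq open_Collect_const continuous_intros)

text \<open>On the domain the two coordinates of an edge sum to at least c > 0, so the denominators
  do not vanish, and the power is continuous up to 0 as \<alpha> > 0.\<close>

lemma continuous_on_field_F: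
  assumes "\<alpha> > 0" "c > 0"
  shows "continuous_on (domain_\<Delta> E c) (\<lambda>x. field_F E \<alpha> x $ i)"
proof -
  have pow: "continuous_on (domain_\<Delta> E c) (\<lambda>x. (x $ i) powr \<alpha>)" for i
    using assms(1) by (intro continuous_on_powr' continuous_intros) (auto simp: domain_\<Delta>_def)
  have "(x $ i) powr \<alpha> + (x $ j) powr \<alpha> \<noteq> 0" if "x \<in> domain_\<Delta> E c" "{i, j} \<in> E" for x i j
  proof -
    have "x $ i + x $ j \<ge> c" using that by (auto simp: domain_\<Delta>_def)
    then have "x $ i \<noteq> 0 \<or> x $ j \<noteq> 0" using assms(2) by auto
    then have "(x $ i) powr \<alpha> > 0 \<or> (x $ j) powr \<alpha> > 0" by auto
    then show ?thesis using powr_ge_zero[of "x $ i" \<alpha>] powr_ge_zero[of "x $ j" \<alpha>] by linarith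
  qed
  then show ?thesis
    unfolding field_F_def vec_lambda_beta
    by (intro continuous_intros pow) auto
qed

theorem theorem1p2:
  fixes M :: "'w measure"
    and E :: "'v::finite set set"
    and \<alpha> c :: real
    and B0 :: "'v \<Rightarrow> nat"
    and B :: "nat \<Rightarrow> 'v \<Rightarrow> 'w \<Rightarrow> nat"
    and C :: "nat \<Rightarrow> 'v set \<Rightarrow> 'w \<Rightarrow> 'v"
  assumes "simple_graph E"
    and "connected_graph E"
    and "card E \<ge> 1"
    and "\<alpha> > 0"
    and "0 < c" "c < 1 / real (card E)"
    and "polya_urn M E \<alpha> B0 B C"
  shows "AE \<omega> in M. limit_set (proportions E B0 B \<omega>) \<subseteq> equilibria E \<alpha> c"
proof -
  interpret polya_urn M E \<alpha> B0 B C by fact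
  interpret graph_urn M E \<alpha> B0 B C by unfold_locales fact+
  show ?thesis
    using AE_summable_drift AE_space
  proof eventually_elim
    case (elim \<omega>)
    let ?x = "proportions E B0 B \<omega>"
    \<comment> \<open>Each coordinate is treated separately, with the square of F_i as the
      nonnegative function in \<open>slow_sequence_limit_set\<close>.\<close>
    have "y \<in> domain_\<Delta> E c \<and> (field_F E \<alpha> y $ i)\<^sup>2 = 0" if y: "y \<in> limit_set ?x" for y i
    proof -
      have "summable (\<lambda>n. (field_F E \<alpha> (?x n) $ i)\<^sup>2 / (real n + 1))"
      proof (rule summable_comparison_test'[OF summable_mult])
        show "summable (\<lambda>n. drift n \<omega>)" by fact
        show "norm ((field_F E \<alpha> (?x n) $ i)\<^sup>2 / (real n + 1))
            \<le> (total 0 + real (card E)) * drift n \<omega>" if "n \<ge> 0" for n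
          using field_F_le_drift[OF elim(2), of n i] by simp
      qed
      moreover have "continuous_on (domain_\<Delta> E c) (\<lambda>x. (field_F E \<alpha> x $ i)\<^sup>2)"
        by (intro continuous_on_power continuous_on_field_F assms)
      ultimately show ?thesis
        using slow_sequence_limit_set[where f = "\<lambda>x. (field_F E \<alpha> x $ i)\<^sup>2", OF closed_domain_\<Delta> _
            eventually_proportions_domain[OF elim(2) assms(5,6)] proportions_slow[OF elim(2)] _ _ y]
        by auto
    qed
    then show ?case by (auto simp: equilibria_def vec_eq_iff)
  qed
qed

end
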